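(* Let $G$ be an étale (localic) groupoid and $X$ a $G$-sheaf. The following conditions are equivalent: 1. $X$ is a principally covered $\mathcal O(G)$-sheaf and it is a bisheaf; 2. $X$ is a principal $G$-sheaf. Furthermore, if these equivalent conditions hold, the set of principal sections $\Gamma^{\mathrm{pr}}_X$ coincides with the set of local bisections $\Gamma^{\mathrm{bi}}_X$.
   Context: Locales: a map of locales $f:X\to Y$ is given by its inverse image frame homomorphism $f^*:Y\to X$; if $f^*$ has a left adjoint it is denoted $f_!$ (direct image). $f$ is open if $f_!$ exists and $f_!(x\wedge f^*(y))=f_!(x)\wedge y$; it is a surjection if $f^*$ is injective; a local homeomorphism is an open map for which there is $S\subset X$ with $\bigvee S=1_X$ such that $f_!$ restricts to isomorphisms ${\downarrow}s\cong{\downarrow}f_!(s)$ for $s\in S$. $X\otimes_B Y$ denotes the pullback of locale maps $X\to B\leftarrow Y$. Groupoids: a localic groupoid $G$ has locales $G_0,G_1$, structure maps $d,r,u,i,m$ (domain, range, units, inversion, multiplication), with $m$ defined on the pullback of $r$ (first factor) and $d$ (second factor). $G$ is étale if $d$ is a local homeomorphism. A (left) $G$-locale is a locale $X$ with a map $p:X\to G_0$ and an associative unital action $\mathfrak a:G_1\otimes_{G_0}X\to X$ (pullback of $r$ and $p$) with $p\circ\mathfrak a=d\circ\pi_1$. It is a $G$-sheaf if $p$ is a local homeomorphism. The orbit locale $\pi:X\to X/G$ is the coequalizer in locales of $\mathfrak a,\pi_2:G_1\otimes_{G_0}X\rightrightarrows X$. A principal $G$-sheaf is a $G$-sheaf $X$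 such that $\pi:X\to X/G$ is an open surjection and $\langle\mathfrak a,\pi_2\rangle:G_1\otimes_{G_0}X\to X\otimes_{X/G}X$ is an isomorphism of locales. Quantale: $Q=\mathcal O(G)$ is the locale $G_1$ with multiplication $ab=m_!(a\otimes b)$, involution $a^*=i_!(a)$, unit $e=u_!(1_{G_0})$. Put $Q_0={\downarrow}e\cong G_0$, $Q_{\mathcal I}=\{s\in Q:ss^*\vee s^*s\le e\}$, and $\varsigma_Q(a)=aa^*\wedge e$. A $G$-locale $X$ is a left $Q$-module by $ax=\mathfrak a_!(a\otimes x)$. For a $G$-sheaf $X$, let $\varsigma_X=u_!\circ p_!:X\to Q_0$; a local section is an $s\in X$ with $\varsigma_X(x)s=x$ for all $x\le s$, and $\Gamma_X$ is the set of local sections. $X$ has a canonical inner product $\langle-,-\rangle:X\times X\to Q$: the unique map preserving joins in each variable with, for $s,t\in\Gamma_X$, $\langle s,t\rangle=\bigvee\{v\in Q_{\mathcal I}:\varsigma_Q(v)\le\varsigma_X(s),\ \varsigma_Q(v^* )\le\varsigma_X(t),\ vt\le s\}$. A principal section is $s\in\Gamma_X$ with $\langle s,s\rangle\le e$; $\Gamma_X^{\mathrm{pr}}$ is the set of these; $X$ is principally covered if $\bigvee\Gamma_X^{\mathrm{pr}}=1_X$. Bisheaves: $X/G$ is identified with $I(X)=\{x\in X:1_Qx=x\}$, with $\pi^*$ the inclusion. $X$ is a bisheaf if it is a $G$-sheaf and $\pi:X\to X/G$ is a local homeomorphism; in that case $\tau:=\pi_!$ is $\tau(x)=1_Qx$,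 and the local sections with respect to $\pi$ are the $s\in X$ with $s\wedge\tau(x)=x$ for all $x\le s$; their set is $\Gamma_X^{\tau}$. The local bisections are $\Gamma_X^{\mathrm{bi}}=\Gamma_X\cap\Gamma_X^{\tau}$. *)

theory Defs
  imports Main
begin

section \<open>Frames and maps of locales\<close>

class frame = complete_lattice +
  assumes inf_Sup_frame: "inf a (Sup B) = Sup ((\<lambda>b. inf a b) ` B)"

text \<open>
  A locale is represented by the carrier \<open>A :: 'a::order set\<close> of its frame, with the order of the
  type.  The locales that are given are types of class \<^class>\<open>frame\<close> (carrier \<^const>\<open>UNIV\<close>); the ones
  constructed from them (pullbacks, orbit locales) are genuine subsets, whose joins need not be
  those of the surrounding type.  Hence lattice operations are taken relative to a carrier.
\<close>

definition join :: "'a::order set \<Rightarrow> 'a set \<Rightarrow> 'a" where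
  "join A S = (LEAST u. u \<in> A \<and> (\<forall>s\<in>S. s \<le> u))"

definition meet :: "'a::order set \<Rightarrow> 'a \<Rightarrow> 'a \<Rightarrow> 'a" where
  "meet A x y = (GREATEST u. u \<in> A \<and> u \<le> x \<and> u \<le> y)"

definition one :: "'a::order set \<Rightarrow> 'a" where
  "one A = (GREATEST u. u \<in> A)"

text \<open>
  A map of locales \<open>f : A \<rightarrow> B\<close> is represented by its inverse image homomorphism
  \<open>f\<^sup>* :: 'b \<Rightarrow> 'a\<close>, which is written simply \<open>f\<close>; composition \<open>f \<circ>\<^sub>L g\<close> is the one of locale maps.
\<close>

definition locale_map :: "'a::order set \<Rightarrow> 'b::order set \<Rightarrow> ('b \<Rightarrow> 'a) \<Rightarrow> bool" where
  "locale_map A B f \<longleftrightarrow>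
     f ` B \<subseteq> A \<and>
     (\<forall>S\<subseteq>B. f (join B S) = join A (f ` S)) \<and>
     (\<forall>x\<in>B. \<forall>y\<in>B. f (meet B x y) = meet A (f x) (f y)) \<and>
     f (one B) = one A"

abbreviation (input) locale_comp :: "('c \<Rightarrow> 'b) \<Rightarrow> ('b \<Rightarrow> 'a) \<Rightarrow> 'c \<Rightarrow> 'a" (infixl "\<circ>\<^sub>L" 55) where
  "f \<circ>\<^sub>L g \<equiv> g \<circ> f"

definition locale_iso :: "'a::order set \<Rightarrow> 'b::order set \<Rightarrow> ('b \<Rightarrow> 'a) \<Rightarrow> bool" where
  "locale_iso A B f \<longleftrightarrow>
     locale_map A B f \<and>
     (\<exists>g. locale_map B A g \<and> (\<forall>x\<in>A. f (g x) = x) \<and> (\<forall>y\<in>B. g (f y) = y))"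

definition surjection :: "'b set \<Rightarrow> ('b \<Rightarrow> 'a) \<Rightarrow> bool" where
  "surjection B f \<longleftrightarrow> inj_on f B"

definition is_left_adjoint ::
    "'a::order set \<Rightarrow> 'b::order set \<Rightarrow> ('a \<Rightarrow> 'b) \<Rightarrow> ('b \<Rightarrow> 'a) \<Rightarrow> bool" where
  "is_left_adjoint A B g f \<longleftrightarrow>
     g ` A \<subseteq> B \<and> (\<forall>x\<in>A. \<forall>y\<in>B. g x \<le> y \<longleftrightarrow> x \<le> f y)"

text \<open>If \<open>f\<^sup>*\<close> has a left adjoint \<open>f\<^sub>!\<close>, then \<^term>\<open>direct_image B f\<close> agrees with it on the carrier.\<close>

definition direct_image :: "'b::order set \<Rightarrow> ('b \<Rightarrow> 'a::order) \<Rightarrow> 'a \<Rightarrow> 'b" where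
  "direct_image B f x = (LEAST y. y \<in> B \<and> x \<le> f y)"

definition open_map :: "'a::order set \<Rightarrow> 'b::order set \<Rightarrow> ('b \<Rightarrow> 'a) \<Rightarrow> bool" where
  "open_map A B f \<longleftrightarrow>
     locale_map A B f \<and>
     is_left_adjoint A B (direct_image B f) f \<and>
     (\<forall>x\<in>A. \<forall>y\<in>B. direct_image B f (meet A x (f y)) = meet B (direct_image B f x) y)"

definition down :: "'a::order set \<Rightarrow> 'a \<Rightarrow> 'a set" where
  "down A s = {x \<in> A. x \<le> s}"

definition order_iso :: "'a::order set \<Rightarrow> 'b::order set \<Rightarrow> ('a \<Rightarrow> 'b) \<Rightarrow> bool" where
  "order_iso A B h \<longleftrightarrow> bij_betw h A B \<and> (\<forall>x\<in>A. \<forall>y\<in>A. h x \<le> h y \<longleftrightarrow> x \<le> y)"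

definition local_homeomorphism :: "'a::order set \<Rightarrow> 'b::order set \<Rightarrow> ('b \<Rightarrow> 'a) \<Rightarrow> bool" where
  "local_homeomorphism A B f \<longleftrightarrow>
     open_map A B f \<and>
     (\<exists>S\<subseteq>A. join A S = one A \<and>
        (\<forall>s\<in>S. order_iso (down A s) (down B (direct_image B f s)) (direct_image B f)))"


section \<open>Pullbacks\<close>

text \<open>
  The pullback \<open>A \<otimes>\<^sub>C B\<close> of \<open>f : A \<rightarrow> C \<leftarrow> B : g\<close> is the pushout of frames, i.e. the tensor product
  of \<open>A\<close> and \<open>B\<close> over \<open>C\<close>.  It is presented in the usual way, by the down-closed subsets of
  \<open>A \<times> B\<close> that are closed under joins in each variable and satisfy
  \<open>(a \<and> f\<^sup>*c) \<otimes> b = a \<otimes> (b \<and> g\<^sup>*c)\<close>, ordered by inclusion.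
\<close>

definition pullback ::
    "'a::order set \<Rightarrow> 'b::order set \<Rightarrow> 'c set \<Rightarrow> ('c \<Rightarrow> 'a) \<Rightarrow> ('c \<Rightarrow> 'b) \<Rightarrow> ('a \<times> 'b) set set" where
  "pullback A B C f g = {U. U \<subseteq> A \<times> B \<and>
     (\<forall>a\<in>A. \<forall>b\<in>B. \<forall>(a', b')\<in>U. a \<le> a' \<and> b \<le> b' \<longrightarrow> (a, b) \<in> U) \<and>
     (\<forall>S\<subseteq>A. \<forall>b\<in>B. (\<forall>a\<in>S. (a, b) \<in> U) \<longrightarrow> (join A S, b) \<in> U) \<and>
     (\<forall>a\<in>A. \<forall>T\<subseteq>B. (\<forall>b\<in>T. (a, b) \<in> U) \<longrightarrow> (a, join B T) \<in> U) \<and>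
     (\<forall>a\<in>A. \<forall>b\<in>B. \<forall>c\<in>C. (meet A a (f c), b) \<in> U \<longleftrightarrow> (a, meet B b (g c)) \<in> U)}"

text \<open>The pure tensor \<open>a \<otimes> b\<close> in a pullback \<open>P\<close>.\<close>

definition tensor :: "('a \<times> 'b) set set \<Rightarrow> 'a \<Rightarrow> 'b \<Rightarrow> ('a \<times> 'b) set" where
  "tensor P a b = \<Inter>{U \<in> P. (a, b) \<in> U}"

text \<open>The projections \<open>\<pi>\<^sub>1\<close> and \<open>\<pi>\<^sub>2\<close> of a pullback \<open>P\<close> of \<open>A\<close> and \<open>B\<close>.\<close>

definition proj1 :: "('a \<times> 'b) set set \<Rightarrow> 'b::order set \<Rightarrow> 'a \<Rightarrow> ('a \<times> 'b) set" where
  "proj1 P B a = tensor P a (one B)"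

definition proj2 :: "('a \<times> 'b) set set \<Rightarrow> 'a::order set \<Rightarrow> 'b \<Rightarrow> ('a \<times> 'b) set" where
  "proj2 P A b = tensor P (one A) b"

text \<open>
  The map \<open>\<langle>f, g\<rangle> : Z \<rightarrow> A \<otimes>\<^sub>C B\<close> induced by \<open>f : Z \<rightarrow> A\<close> and \<open>g : Z \<rightarrow> B\<close>; its inverse image sends
  \<open>a \<otimes> b\<close> to \<open>f\<^sup>*a \<and> g\<^sup>*b\<close>.
\<close>

definition pairing ::
    "'z::order set \<Rightarrow> ('a \<Rightarrow> 'z) \<Rightarrow> ('b \<Rightarrow> 'z) \<Rightarrow> ('a \<times> 'b) set \<Rightarrow> 'z" where
  "pairing Z f g U = join Z ((\<lambda>(a, b). meet Z (f a) (g b)) ` U)"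


section \<open>Localic groupoids\<close>

record ('o, 'g) groupoid =
  gd :: "'o \<Rightarrow> 'g"
  gr :: "'o \<Rightarrow> 'g"
  gu :: "'g \<Rightarrow> 'o"
  gi :: "'g \<Rightarrow> 'g"
  gm :: "'g \<Rightarrow> ('g \<times> 'g) set"

definition G2 :: "('o::frame, 'g::frame) groupoid \<Rightarrow> ('g \<times> 'g) set set" where
  "G2 G = pullback UNIV UNIV UNIV (gr G) (gd G)"

abbreviation G2_\<pi>1 :: "('o::frame, 'g::frame) groupoid \<Rightarrow> 'g \<Rightarrow> ('g \<times> 'g) set" where
  "G2_\<pi>1 G \<equiv> proj1 (G2 G) UNIV"

abbreviation G2_\<pi>2 :: "('o::frame, 'g::frame) groupoid \<Rightarrow> 'g \<Rightarrow> ('g \<times> 'g) set" where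
  "G2_\<pi>2 G \<equiv> proj2 (G2 G) UNIV"

definition G3 :: "('o::frame, 'g::frame) groupoid \<Rightarrow> ('g \<times> ('g \<times> 'g) set) set set" where
  "G3 G = pullback UNIV (G2 G) UNIV (gr G) (gd G \<circ>\<^sub>L G2_\<pi>1 G)"

text \<open>In point notation, the associativity axiom reads \<open>g (h k) = (g h) k\<close> for \<open>(g, (h, k))\<close> in \<open>G3\<close>.\<close>

definition localic_groupoid :: "('o::frame, 'g::frame) groupoid \<Rightarrow> bool" where
  "localic_groupoid G \<longleftrightarrow>
     locale_map (UNIV :: 'g set) (UNIV :: 'o set) (gd G) \<and>
     locale_map (UNIV :: 'g set) (UNIV :: 'o set) (gr G) \<and>
     locale_map (UNIV :: 'o set) (UNIV :: 'g set) (gu G) \<and>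
     locale_map (UNIV :: 'g set) (UNIV :: 'g set) (gi G) \<and>
     locale_map (G2 G) UNIV (gm G) \<and>
     gd G \<circ>\<^sub>L gu G = id \<and> gr G \<circ>\<^sub>L gu G = id \<and>
     gd G \<circ>\<^sub>L gm G = gd G \<circ>\<^sub>L G2_\<pi>1 G \<and>
     gr G \<circ>\<^sub>L gm G = gr G \<circ>\<^sub>L G2_\<pi>2 G \<and>
     (let \<pi>1 = proj1 (G3 G) (G2 G); \<pi>2 = proj2 (G3 G) UNIV in
        gm G \<circ>\<^sub>L pairing (G3 G) \<pi>1 (gm G \<circ>\<^sub>L \<pi>2) =
        gm G \<circ>\<^sub>L pairing (G3 G)
                  (gm G \<circ>\<^sub>L pairing (G3 G) \<pi>1 (G2_\<pi>1 G \<circ>\<^sub>L \<pi>2)) (G2_\<pi>2 G \<circ>\<^sub>L \<pi>2)) \<and>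
     gm G \<circ>\<^sub>L pairing UNIV (gu G \<circ>\<^sub>L gd G) id = id \<and>
     gm G \<circ>\<^sub>L pairing UNIV id (gu G \<circ>\<^sub>L gr G) = id \<and>
     gd G \<circ>\<^sub>L gi G = gr G \<and> gr G \<circ>\<^sub>L gi G = gd G \<and>
     gm G \<circ>\<^sub>L pairing UNIV id (gi G) = gu G \<circ>\<^sub>L gd G \<and>
     gm G \<circ>\<^sub>L pairing UNIV (gi G) id = gu G \<circ>\<^sub>L gr G"

definition etale_groupoid :: "('o::frame, 'g::frame) groupoid \<Rightarrow> bool" where
  "etale_groupoid G \<longleftrightarrow>
     localic_groupoid G \<and> local_homeomorphism (UNIV :: 'g set) (UNIV :: 'o set) (gd G)"


section \<open>Actions, sheaves and orbits\<close>

text \<open>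
  A \<open>G\<close>-locale is a type \<open>'x\<close> of class \<^class>\<open>frame\<close> together with (the inverse images of) its anchor
  map \<open>p : X \<rightarrow> G\<^sub>0\<close> and its action \<open>\<alpha> : G\<^sub>1 \<otimes> X \<rightarrow> X\<close>.
\<close>

definition GX :: "('o::frame, 'g::frame) groupoid \<Rightarrow> ('o \<Rightarrow> 'x::frame) \<Rightarrow> ('g \<times> 'x) set set" where
  "GX G p = pullback UNIV UNIV UNIV (gr G) p"

abbreviation GX_\<pi>1 ::
    "('o::frame, 'g::frame) groupoid \<Rightarrow> ('o \<Rightarrow> 'x::frame) \<Rightarrow> 'g \<Rightarrow> ('g \<times> 'x) set" where
  "GX_\<pi>1 G p \<equiv> proj1 (GX G p) UNIV"

abbreviation GX_\<pi>2 ::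
    "('o::frame, 'g::frame) groupoid \<Rightarrow> ('o \<Rightarrow> 'x::frame) \<Rightarrow> 'x \<Rightarrow> ('g \<times> 'x) set" where
  "GX_\<pi>2 G p \<equiv> proj2 (GX G p) UNIV"

definition GGX ::
    "('o::frame, 'g::frame) groupoid \<Rightarrow> ('o \<Rightarrow> 'x::frame) \<Rightarrow> ('g \<times> ('g \<times> 'x) set) set set" where
  "GGX G p = pullback UNIV (GX G p) UNIV (gr G) (gd G \<circ>\<^sub>L GX_\<pi>1 G p)"

definition G_locale ::
    "('o::frame, 'g::frame) groupoid \<Rightarrow> ('o \<Rightarrow> 'x::frame) \<Rightarrow> ('x \<Rightarrow> ('g \<times> 'x) set) \<Rightarrow> bool" where
  "G_locale G p \<alpha> \<longleftrightarrow>
     locale_map (UNIV :: 'x set) (UNIV :: 'o set) p \<and>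
     locale_map (GX G p) UNIV \<alpha> \<and>
     p \<circ>\<^sub>L \<alpha> = gd G \<circ>\<^sub>L GX_\<pi>1 G p \<and>
     (let \<pi>1 = proj1 (GGX G p) (GX G p); \<pi>2 = proj2 (GGX G p) UNIV in
        \<alpha> \<circ>\<^sub>L pairing (GGX G p) \<pi>1 (\<alpha> \<circ>\<^sub>L \<pi>2) =
        \<alpha> \<circ>\<^sub>L pairing (GGX G p)
               (gm G \<circ>\<^sub>L pairing (GGX G p) \<pi>1 (GX_\<pi>1 G p \<circ>\<^sub>L \<pi>2)) (GX_\<pi>2 G p \<circ>\<^sub>L \<pi>2)) \<and>
     \<alpha> \<circ>\<^sub>L pairing UNIV (gu G \<circ>\<^sub>L p) id = id"

definition G_sheaf ::
    "('o::frame, 'g::frame) groupoid \<Rightarrow> ('o \<Rightarrow> 'x::frame) \<Rightarrow> ('x \<Rightarrow> ('g \<times> 'x) set) \<Rightarrow> bool" where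
  "G_sheaf G p \<alpha> \<longleftrightarrow>
     G_locale G p \<alpha> \<and> local_homeomorphism (UNIV :: 'x set) (UNIV :: 'o set) p"

text \<open>
  The coequalizer of \<open>\<alpha>\<close> and \<open>\<pi>\<^sub>2\<close> in locales is the equalizer of their inverse images in frames, and
  this is the subframe below; the inverse image of the quotient map \<open>\<pi> : X \<rightarrow> X/G\<close> is the inclusion,
  so \<open>\<pi>\<close> is represented by \<^const>\<open>id\<close>.
\<close>

definition orbit_locale ::
    "('o::frame, 'g::frame) groupoid \<Rightarrow> ('o \<Rightarrow> 'x::frame) \<Rightarrow> ('x \<Rightarrow> ('g \<times> 'x) set) \<Rightarrow> 'x set" where
  "orbit_locale G p \<alpha> = {x. \<alpha> x = GX_\<pi>2 G p x}"

abbreviation (input) orbit_map :: "'x \<Rightarrow> 'x" where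
  "orbit_map \<equiv> id"

definition principal_G_sheaf ::
    "('o::frame, 'g::frame) groupoid \<Rightarrow> ('o \<Rightarrow> 'x::frame) \<Rightarrow> ('x \<Rightarrow> ('g \<times> 'x) set) \<Rightarrow> bool" where
  "principal_G_sheaf G p \<alpha> \<longleftrightarrow>
     G_sheaf G p \<alpha> \<and>
     open_map UNIV (orbit_locale G p \<alpha>) orbit_map \<and>
     surjection (orbit_locale G p \<alpha>) (orbit_map :: 'x \<Rightarrow> 'x) \<and>
     locale_iso (GX G p) (pullback UNIV UNIV (orbit_locale G p \<alpha>) orbit_map orbit_map)
       (pairing (GX G p) \<alpha> (GX_\<pi>2 G p))"

definition bisheaf ::
    "('o::frame, 'g::frame) groupoid \<Rightarrow> ('o \<Rightarrow> 'x::frame) \<Rightarrow> ('x \<Rightarrow> ('g \<times> 'x) set) \<Rightarrow> bool" where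
  "bisheaf G p \<alpha> \<longleftrightarrow>
     G_sheaf G p \<alpha> \<and> local_homeomorphism UNIV (orbit_locale G p \<alpha>) orbit_map"


section \<open>The quantale of a groupoid and its modules\<close>

definition qmult :: "('o::frame, 'g::frame) groupoid \<Rightarrow> 'g \<Rightarrow> 'g \<Rightarrow> 'g" where
  "qmult G a b = direct_image UNIV (gm G) (tensor (G2 G) a b)"

definition qstar :: "('o::frame, 'g::frame) groupoid \<Rightarrow> 'g \<Rightarrow> 'g" where
  "qstar G a = direct_image UNIV (gi G) a"

definition qunit :: "('o::frame, 'g::frame) groupoid \<Rightarrow> 'g" where
  "qunit G = direct_image UNIV (gu G) top"

definition partial_units :: "('o::frame, 'g::frame) groupoid \<Rightarrow> 'g set" where
  "partial_units G = {s. sup (qmult G s (qstar G s)) (qmult G (qstar G s) s) \<le> qunit G}"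

definition qsupp :: "('o::frame, 'g::frame) groupoid \<Rightarrow> 'g \<Rightarrow> 'g" where
  "qsupp G a = inf (qmult G a (qstar G a)) (qunit G)"

definition qact ::
    "('o::frame, 'g::frame) groupoid \<Rightarrow> ('o \<Rightarrow> 'x::frame) \<Rightarrow> ('x \<Rightarrow> ('g \<times> 'x) set) \<Rightarrow> 'g \<Rightarrow> 'x \<Rightarrow> 'x" where
  "qact G p \<alpha> a x = direct_image UNIV \<alpha> (tensor (GX G p) a x)"

definition xsupp :: "('o::frame, 'g::frame) groupoid \<Rightarrow> ('o \<Rightarrow> 'x::frame) \<Rightarrow> 'x \<Rightarrow> 'g" where
  "xsupp G p x = direct_image UNIV (gu G) (direct_image UNIV p x)"

definition local_sections ::
    "('o::frame, 'g::frame) groupoid \<Rightarrow> ('o \<Rightarrow> 'x::frame) \<Rightarrow> ('x \<Rightarrow> ('g \<times> 'x) set) \<Rightarrow> 'x set" where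
  "local_sections G p \<alpha> = {s. \<forall>x\<le>s. qact G p \<alpha> (xsupp G p x) s = x}"

definition is_inner_product ::
    "('o::frame, 'g::frame) groupoid \<Rightarrow> ('o \<Rightarrow> 'x::frame) \<Rightarrow> ('x \<Rightarrow> ('g \<times> 'x) set)
      \<Rightarrow> ('x \<Rightarrow> 'x \<Rightarrow> 'g) \<Rightarrow> bool" where
  "is_inner_product G p \<alpha> \<phi> \<longleftrightarrow>
     (\<forall>S y. \<phi> (Sup S) y = Sup ((\<lambda>x. \<phi> x y) ` S)) \<and>
     (\<forall>x T. \<phi> x (Sup T) = Sup (\<phi> x ` T)) \<and>
     (\<forall>s\<in>local_sections G p \<alpha>. \<forall>t\<in>local_sections G p \<alpha>.
        \<phi> s t = Sup {v \<in> partial_units G. qsupp G v \<le> xsupp G p s \<and>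
                       qsupp G (qstar G v) \<le> xsupp G p t \<and> qact G p \<alpha> v t \<le> s})"

definition inner_product ::
    "('o::frame, 'g::frame) groupoid \<Rightarrow> ('o \<Rightarrow> 'x::frame) \<Rightarrow> ('x \<Rightarrow> ('g \<times> 'x) set)
      \<Rightarrow> 'x \<Rightarrow> 'x \<Rightarrow> 'g" where
  "inner_product G p \<alpha> = (THE \<phi>. is_inner_product G p \<alpha> \<phi>)"

definition principal_sections ::
    "('o::frame, 'g::frame) groupoid \<Rightarrow> ('o \<Rightarrow> 'x::frame) \<Rightarrow> ('x \<Rightarrow> ('g \<times> 'x) set) \<Rightarrow> 'x set" where
  "principal_sections G p \<alpha> =
     {s \<in> local_sections G p \<alpha>. inner_product G p \<alpha> s s \<le> qunit G}"

definition principally_covered_sheaf ::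
    "('o::frame, 'g::frame) groupoid \<Rightarrow> ('o \<Rightarrow> 'x::frame) \<Rightarrow> ('x \<Rightarrow> ('g \<times> 'x) set) \<Rightarrow> bool" where
  "principally_covered_sheaf G p \<alpha> \<longleftrightarrow>
     G_sheaf G p \<alpha> \<and> Sup (principal_sections G p \<alpha>) = top"

text \<open>Here \<open>\<pi>\<^sup>*\<close> is suppressed, being the inclusion.\<close>

definition orbit_sections ::
    "('o::frame, 'g::frame) groupoid \<Rightarrow> ('o \<Rightarrow> 'x::frame) \<Rightarrow> ('x \<Rightarrow> ('g \<times> 'x) set) \<Rightarrow> 'x set" where
  "orbit_sections G p \<alpha> =
     {s. \<forall>x\<le>s. inf s (direct_image (orbit_locale G p \<alpha>) orbit_map x) = x}"

definition local_bisections ::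
    "('o::frame, 'g::frame) groupoid \<Rightarrow> ('o \<Rightarrow> 'x::frame) \<Rightarrow> ('x \<Rightarrow> ('g \<times> 'x) set) \<Rightarrow> 'x set" where
  "local_bisections G p \<alpha> = local_sections G p \<alpha> \<inter> orbit_sections G p \<alpha>"

end

theory Submission
  imports Defs
begin

text \<open>
  The bisections \<open>v\<close> of \<open>G\<close>, that is, the common sections of \<open>d\<close> and \<open>r\<close>, cover \<open>G\<^sub>1\<close> and act on \<open>X\<close> by
  partial isomorphisms \<open>p\<^sup>*(r\<^sub>! v) \<cong> p\<^sup>*(d\<^sub>! v)\<close>, and an open part of \<open>G\<^sub>1 \<otimes> X\<close> is determined by its restrictions
  to the parts \<open>v \<otimes> X \<cong> p\<^sup>*(r\<^sub>! v)\<close>.  This reduces everything to the frame \<open>X\<close>.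

  A local section \<open>s\<close> is principal iff \<open>g z \<in> s\<close> and \<open>z \<in> s\<close> force \<open>g\<close> to be a unit.  If \<open>X\<close> is principal,
  then this says that \<open>s \<otimes> s\<close> lies in the diagonal of \<open>X \<otimes> X\<close> over \<open>X/G\<close>, which is open as the units are open
  in \<open>G\<^sub>1\<close>; openness of the diagonal makes \<open>\<pi>\<close> a local homeomorphism, whose sections are the \<open>s\<close> with \<open>s \<otimes> s\<close>
  in the diagonal.  Conversely, principal sections \<open>y\<close> make \<open>\<langle>\<alpha>, \<pi>\<^sub>2\<rangle>\<close> an embedding, since \<open>v \<otimes> y\<close> is
  the inverse image of \<open>v y \<otimes> y\<close>, and sections \<open>s\<close> of \<open>\<pi>\<close> make it surjective, since the pairs
  \<open>v s \<otimes> s\<close> cover the kernel pair of \<open>\<pi>\<close>.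
\<close>

section \<open>Frames and carriers\<close>

lemma inf_SUP_frame: "inf (a::'a::frame) (SUP x\<in>S. f x) = (SUP x\<in>S. inf a (f x))"
  by (simp add: inf_Sup_frame image_image)

lemma SUP_inf_frame: "inf (SUP x\<in>S. f x) (a::'a::frame) = (SUP x\<in>S. inf (f x) a)"
  using inf_SUP_frame[of a f S] by (simp add: inf_commute)

lemma join_UNIV: "join UNIV S = Sup (S :: 'a::complete_lattice set)"
  unfolding join_def by (rule Least_equality) (auto intro: Sup_upper Sup_least)

lemma meet_UNIV: "meet UNIV x y = inf x (y :: 'a::complete_lattice)"
  unfolding meet_def by (rule Greatest_equality) auto

lemma one_UNIV: "one UNIV = (top :: 'a::complete_lattice)"
  unfolding one_def by (rule Greatest_equality) auto

text \<open>Least upper bounds are sought inside \<open>A\<close>: a pullback is a complete carrier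
  although its joins are closures, not unions.\<close>

definition complete_carrier :: "'a::order set \<Rightarrow> bool" where
  "complete_carrier A \<longleftrightarrow>
     (\<forall>S\<subseteq>A. \<exists>u\<in>A. (\<forall>s\<in>S. s \<le> u) \<and> (\<forall>w\<in>A. (\<forall>s\<in>S. s \<le> w) \<longrightarrow> u \<le> w))"

lemma complete_carrier_UNIV: "complete_carrier (UNIV :: 'a::complete_lattice set)"
  unfolding complete_carrier_def by (meson Sup_upper Sup_least UNIV_I)

lemma
  assumes "complete_carrier A" "S \<subseteq> A"
  shows join_in: "join A S \<in> A"
    and join_le_iff: "w \<in> A \<Longrightarrow> join A S \<le> w \<longleftrightarrow> (\<forall>s\<in>S. s \<le> w)"
proof -
  obtain u where u: "u \<in> A" "\<forall>s\<in>S. s \<le> u" "\<forall>w\<in>A. (\<forall>s\<in>S. s \<le> w) \<longrightarrow> u \<le> w"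
    using assms unfolding complete_carrier_def by blast
  have "join A S = u"
    unfolding join_def by (rule Least_equality) (use u in auto)
  with u show "join A S \<in> A" "w \<in> A \<Longrightarrow> join A S \<le> w \<longleftrightarrow> (\<forall>s\<in>S. s \<le> w)"
    by (auto intro: order_trans)
qed

lemma join_upper: "complete_carrier A \<Longrightarrow> S \<subseteq> A \<Longrightarrow> s \<in> S \<Longrightarrow> s \<le> join A S"
  using join_in join_le_iff by blast

lemma
  assumes "complete_carrier A" "x \<in> A" "y \<in> A"
  shows meet_in: "meet A x y \<in> A"
    and le_meet_iff: "w \<in> A \<Longrightarrow> w \<le> meet A x y \<longleftrightarrow> w \<le> x \<and> w \<le> y"
proof -
  let ?u = "join A {w \<in> A. w \<le> x \<and> w \<le> y}"
  have u: "?u \<in> A" "?u \<le> x" "?u \<le> y"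
    using assms by (auto simp: join_in join_le_iff)
  have ub: "w \<le> ?u" if "w \<in> A" "w \<le> x" "w \<le> y" for w
    using assms that by (auto intro: join_upper)
  have "meet A x y = ?u"
    unfolding meet_def by (rule Greatest_equality) (use u ub in auto)
  with u ub show "meet A x y \<in> A" "w \<in> A \<Longrightarrow> w \<le> meet A x y \<longleftrightarrow> w \<le> x \<and> w \<le> y"
    by (auto intro: order_trans)
qed

lemma meet_le1: "complete_carrier A \<Longrightarrow> x \<in> A \<Longrightarrow> y \<in> A \<Longrightarrow> meet A x y \<le> x"
  and meet_le2: "complete_carrier A \<Longrightarrow> x \<in> A \<Longrightarrow> y \<in> A \<Longrightarrow> meet A x y \<le> y"
  using meet_in le_meet_iff by blast+

lemma
  assumes "complete_carrier A"
  shows one_in: "one A \<in> A" and le_one: "w \<in> A \<Longrightarrow> w \<le> one A"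
proof -
  have "one A = join A A"
    unfolding one_def
    by (rule Greatest_equality) (use assms in \<open>auto simp: join_in intro: join_upper\<close>)
  then show "one A \<in> A" "w \<in> A \<Longrightarrow> w \<le> one A"
    using assms by (auto simp: join_in intro: join_upper)
qed

text \<open>Joins, meets and the top are determined by the order, so an order isomorphism transports
  them. For the comparison map it then suffices to check bijectivity and the order.\<close>

lemma order_iso_imp_locale_map:
  assumes A: "complete_carrier A" and B: "complete_carrier B" and h: "order_iso B A h"
  shows "locale_map A B h"
proof -
  have le: "h x \<le> h y \<longleftrightarrow> x \<le> y" if "x \<in> B" "y \<in> B" for x y
    using h that by (simp add: order_iso_def)
  have im: "h ` B = A" using h by (simp add: order_iso_def bij_betw_def)
  have onto: "\<exists>y\<in>B. x = h y" if "x \<in> A" for x using that im by auto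
  have "h (join B S) = join A (h ` S)" if S: "S \<subseteq> B" for S
  proof (rule antisym)
    have hS: "h ` S \<subseteq> A" using S im by auto
    obtain y where y: "y \<in> B" "join A (h ` S) = h y" using onto join_in[OF A hS] by auto
    have "\<forall>s\<in>S. h s \<le> h y" using join_upper[OF A hS] y by auto
    then have "join B S \<le> y" using S y B le by (auto simp: join_le_iff subset_iff)
    then show "h (join B S) \<le> join A (h ` S)" using y le join_in[OF B S] by auto
    show "join A (h ` S) \<le> h (join B S)"
      using S im hS A B le join_in[OF B S] join_upper[OF B S] by (auto simp: join_le_iff subset_iff)
  qed
  moreover have "h (meet B x y) = meet A (h x) (h y)" if xy: "x \<in> B" "y \<in> B" for x y
  proof (rule antisym)
    have hxy: "h x \<in> A" "h y \<in> A" "h (meet B x y) \<in> A" using xy im meet_in[OF B xy] by auto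
    show "h (meet B x y) \<le> meet A (h x) (h y)"
      using le_meet_iff[OF A hxy(1,2)] hxy le xy meet_in[OF B xy] meet_le1[OF B xy] meet_le2[OF B xy]
      by auto
    obtain z where z: "z \<in> B" "meet A (h x) (h y) = h z"
      using onto meet_in[OF A hxy(1,2)] by auto
    then have "z \<le> x" "z \<le> y"
      using meet_le1[OF A hxy(1,2)] meet_le2[OF A hxy(1,2)] xy le by auto
    then show "meet A (h x) (h y) \<le> h (meet B x y)"
      using z le xy le_meet_iff[OF B xy] meet_in[OF B xy] by auto
  qed
  moreover have "h (one B) = one A"
  proof -
    obtain z where "z \<in> B" "one A = h z" using onto one_in[OF A] by auto
    then have "one A \<le> h (one B)" using le one_in[OF B] le_one[OF B] by auto
    moreover have "h (one B) \<in> A" using im one_in[OF B] by auto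
    ultimately show ?thesis using le_one[OF A] by (auto intro: antisym)
  qed
  ultimately show ?thesis using im by (auto simp: locale_map_def)
qed

lemma order_iso_imp_locale_iso:
  assumes A: "complete_carrier A" and B: "complete_carrier B" and h: "order_iso B A h"
  shows "locale_iso A B h"
proof -
  from h have bij: "bij_betw h B A" by (simp add: order_iso_def)
  let ?g = "the_inv_into B h"
  have gb: "bij_betw ?g A B" using bij by (rule bij_betw_the_inv_into)
  have hg: "h (?g x) = x" if "x \<in> A" for x
    using f_the_inv_into_f_bij_betw[OF bij] that by auto
  have gh: "?g (h y) = y" if "y \<in> B" for y
    using the_inv_into_f_f bij that by (metis bij_betw_def)
  have "order_iso A B ?g"
    unfolding order_iso_def
  proof (intro conjI ballI gb)
    fix x y assume "x \<in> A" "y \<in> A"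
    moreover from this have "?g x \<in> B" "?g y \<in> B" using gb by (auto simp: bij_betw_def)
    ultimately show "?g x \<le> ?g y \<longleftrightarrow> x \<le> y" using h hg unfolding order_iso_def by metis
  qed
  then show ?thesis
    unfolding locale_iso_def
    using order_iso_imp_locale_map[OF A B h] order_iso_imp_locale_map[OF B A] hg gh by blast
qed


section \<open>Pullbacks along frames\<close>

text \<open>
  All pullbacks that occur have a full frame as their first factor; the second factor \<open>B\<close> is a proper
  carrier in the case of triple products.
\<close>

locale pullback_frame =
  fixes B :: "'b::order set" and C :: "'c set" and F :: "'c \<Rightarrow> 'a::frame" and K :: "'c \<Rightarrow> 'b"
  assumes carrier: "complete_carrier B" and K_in: "c \<in> C \<Longrightarrow> K c \<in> B"
begin

abbreviation P where "P \<equiv> pullback UNIV B C F K"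

lemma pullbackI:
  assumes "U \<subseteq> UNIV \<times> B"
    and "\<And>a b a' b'. (a', b') \<in> U \<Longrightarrow> b \<in> B \<Longrightarrow> a \<le> a' \<Longrightarrow> b \<le> b' \<Longrightarrow> (a, b) \<in> U"
    and "\<And>S b. b \<in> B \<Longrightarrow> (\<And>a. a \<in> S \<Longrightarrow> (a, b) \<in> U) \<Longrightarrow> (Sup S, b) \<in> U"
    and "\<And>a T. T \<subseteq> B \<Longrightarrow> (\<And>b. b \<in> T \<Longrightarrow> (a, b) \<in> U) \<Longrightarrow> (a, join B T) \<in> U"
    and "\<And>a b c. b \<in> B \<Longrightarrow> c \<in> C \<Longrightarrow> (inf a (F c), b) \<in> U \<longleftrightarrow> (a, meet B b (K c)) \<in> U"
  shows "U \<in> P"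
  unfolding pullback_def mem_Collect_eq join_UNIV meet_UNIV
proof (intro conjI ballI allI impI)
  show "(inf a (F c), b) \<in> U \<longleftrightarrow> (a, meet B b (K c)) \<in> U" if "b \<in> B" "c \<in> C" for a b c
    using that by (rule assms(5))
  show "case x of (a', b') \<Rightarrow> a \<le> a' \<and> b \<le> b' \<longrightarrow> (a, b) \<in> U" if "b \<in> B" "x \<in> U" for a b x
    using that assms(2) by (cases x) auto
  show "(Sup S, b) \<in> U" if "b \<in> B" "\<forall>a\<in>S. (a, b) \<in> U" for S b
    using that by (simp add: assms(3))
  show "(a, join B T) \<in> U" if "T \<subseteq> B" "\<forall>b\<in>T. (a, b) \<in> U" for a T
    using that by (simp add: assms(4))
qed (rule assms(1))

lemma
  assumes "U \<in> P"
  shows pullback_sub: "(a, b) \<in> U \<Longrightarrow> b \<in> B"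
    and pullback_down: "(a', b') \<in> U \<Longrightarrow> b \<in> B \<Longrightarrow> a \<le> a' \<Longrightarrow> b \<le> b' \<Longrightarrow> (a, b) \<in> U"
    and pullback_Sup: "b \<in> B \<Longrightarrow> (\<And>a. a \<in> S \<Longrightarrow> (a, b) \<in> U) \<Longrightarrow> (Sup S, b) \<in> U"
    and pullback_join: "T \<subseteq> B \<Longrightarrow> (\<And>b. b \<in> T \<Longrightarrow> (a, b) \<in> U) \<Longrightarrow> (a, join B T) \<in> U"
    and pullback_swap:
      "b \<in> B \<Longrightarrow> c \<in> C \<Longrightarrow> (inf a (F c), b) \<in> U \<longleftrightarrow> (a, meet B b (K c)) \<in> U"
proof -
  note U = assms[unfolded pullback_def mem_Collect_eq join_UNIV meet_UNIV]
  show "(a, b) \<in> U \<Longrightarrow> b \<in> B" using U by auto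
  show "(a', b') \<in> U \<Longrightarrow> b \<in> B \<Longrightarrow> a \<le> a' \<Longrightarrow> b \<le> b' \<Longrightarrow> (a, b) \<in> U"
    using U[THEN conjunct2, THEN conjunct1] by fast
  show "b \<in> B \<Longrightarrow> (\<And>a. a \<in> S \<Longrightarrow> (a, b) \<in> U) \<Longrightarrow> (Sup S, b) \<in> U" using U by simp
  show "T \<subseteq> B \<Longrightarrow> (\<And>b. b \<in> T \<Longrightarrow> (a, b) \<in> U) \<Longrightarrow> (a, join B T) \<in> U" using U by simp
  show "b \<in> B \<Longrightarrow> c \<in> C \<Longrightarrow> (inf a (F c), b) \<in> U \<longleftrightarrow> (a, meet B b (K c)) \<in> U" using U by simp
qed

lemma top_in_pullback: "UNIV \<times> B \<in> P"
  by (rule pullbackI) (auto simp: join_in[OF carrier] meet_in[OF carrier] K_in)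

text \<open>Every defining condition survives intersections, so \<open>P\<close> is a closure
  system: joins are closures, meets are intersections, and a pure tensor is the least member
  containing its pair.\<close>

lemma Inter_in_pullback:
  assumes "\<S> \<subseteq> P" "\<S> \<noteq> {}"
  shows "\<Inter>\<S> \<in> P"
proof (rule pullbackI)
  have in_P: "U \<in> P" if "U \<in> \<S>" for U using that assms by auto
  show "\<Inter>\<S> \<subseteq> UNIV \<times> B" using pullback_sub in_P assms(2) by fastforce
  show "(a, b) \<in> \<Inter>\<S>" if "(a', b') \<in> \<Inter>\<S>" "b \<in> B" "a \<le> a'" "b \<le> b'" for a b a' b'
    using that pullback_down in_P by blast
  show "(Sup S, b) \<in> \<Inter>\<S>" if "b \<in> B" "\<And>a. a \<in> S \<Longrightarrow> (a, b) \<in> \<Inter>\<S>" for S b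
    using that pullback_Sup in_P by (meson Inter_iff)
  show "(a, join B T) \<in> \<Inter>\<S>" if "T \<subseteq> B" "\<And>b. b \<in> T \<Longrightarrow> (a, b) \<in> \<Inter>\<S>" for a T
    using that pullback_join in_P by (meson Inter_iff)
  show "(inf a (F c), b) \<in> \<Inter>\<S> \<longleftrightarrow> (a, meet B b (K c)) \<in> \<Inter>\<S>" if "b \<in> B" "c \<in> C" for a b c
    using that pullback_swap in_P by (meson Inter_iff)
qed

lemma Int_in_pullback: "U \<in> P \<Longrightarrow> V \<in> P \<Longrightarrow> U \<inter> V \<in> P"
  using Inter_in_pullback[of "{U, V}"] by simp

lemma pullback_carrier: "complete_carrier P"
  unfolding complete_carrier_def
proof (intro allI impI)
  fix \<S> assume "\<S> \<subseteq> P"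
  let ?u = "\<Inter>{W \<in> P. \<forall>s\<in>\<S>. s \<subseteq> W}"
  have "UNIV \<times> B \<in> {W \<in> P. \<forall>s\<in>\<S>. s \<subseteq> W}"
    using top_in_pullback \<open>\<S> \<subseteq> P\<close> pullback_sub by fast
  then have "?u \<in> P" by (intro Inter_in_pullback) auto
  then show "\<exists>u\<in>P. (\<forall>s\<in>\<S>. s \<le> u) \<and> (\<forall>w\<in>P. (\<forall>s\<in>\<S>. s \<le> w) \<longrightarrow> u \<le> w)"
    by (intro bexI[of _ ?u]) auto
qed

lemma meet_pullback: "U \<in> P \<Longrightarrow> V \<in> P \<Longrightarrow> meet P U V = U \<inter> V"
  unfolding meet_def by (rule Greatest_equality) (auto simp: Int_in_pullback)

lemma one_pullback: "one P = UNIV \<times> B"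
  unfolding one_def by (rule Greatest_equality) (use top_in_pullback pullback_sub in fast)+

lemma
  assumes "b \<in> B"
  shows tensor_in: "tensor P a b \<in> P"
    and tensor_mem: "(a, b) \<in> tensor P a b"
    and tensor_le_iff: "W \<in> P \<Longrightarrow> tensor P a b \<subseteq> W \<longleftrightarrow> (a, b) \<in> W"
proof -
  have ne: "{U \<in> P. (a, b) \<in> U} \<noteq> {}" using top_in_pullback assms by auto
  show in_P: "tensor P a b \<in> P" unfolding tensor_def by (rule Inter_in_pullback) (use ne in auto)
  show mem: "(a, b) \<in> tensor P a b" by (auto simp: tensor_def)
  show "tensor P a b \<subseteq> W \<longleftrightarrow> (a, b) \<in> W" if "W \<in> P"
    using that mem by (auto simp: tensor_def)
qed

lemma proj1_in: "proj1 P B a \<in> P" and proj2_in: "b \<in> B \<Longrightarrow> proj2 P UNIV b \<in> P"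
  by (simp_all add: proj1_def proj2_def tensor_in one_in[OF carrier])

lemma pairing_in:
  assumes "\<And>a b. (a, b) \<in> U \<Longrightarrow> f a \<in> P" "\<And>a b. (a, b) \<in> U \<Longrightarrow> g b \<in> P"
  shows "pairing P f g U \<in> P"
  unfolding pairing_def
proof (rule join_in[OF pullback_carrier], clarify)
  fix a b assume "(a, b) \<in> U"
  then show "meet P (f a) (g b) \<in> P" using assms by (intro meet_in[OF pullback_carrier])
qed

end

lemma pullback_frame_UNIV: "pullback_frame (UNIV :: 'b::frame set) C K"
  by standard (auto simp: complete_carrier_UNIV)

text \<open>
  Partial points with values in the opens of \<open>Z\<close>: a frame homomorphism into \<open>\<down>(f \<top>)\<close>, seen as a map into
  the frame of \<open>Z\<close>, is a generalized point of a locale defined on the open part \<open>f \<top>\<close> of \<open>Z\<close>.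
\<close>

definition partial_point :: "('a::frame \<Rightarrow> 'z::frame) \<Rightarrow> bool" where
  "partial_point f \<longleftrightarrow> (\<forall>S. f (Sup S) = Sup (f ` S)) \<and> (\<forall>x y. f (inf x y) = inf (f x) (f y))"

lemma
  assumes "partial_point f"
  shows partial_point_Sup: "f (Sup S) = Sup (f ` S)"
    and partial_point_inf: "f (inf x y) = inf (f x) (f y)"
    and partial_point_mono: "x \<le> y \<Longrightarrow> f x \<le> f y"
    and partial_point_le_top: "f x \<le> f top"
  using assms unfolding partial_point_def by (auto simp: le_iff_inf) (metis inf_top_right)+

lemma partial_point_id: "partial_point id"
  by (simp add: partial_point_def)

lemma partial_point_comp: "partial_point f \<Longrightarrow> partial_point g \<Longrightarrow> partial_point (g \<circ> f)"
  by (auto simp: partial_point_def image_comp)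

lemma locale_map_UNIV_iff:
  "locale_map UNIV UNIV f \<longleftrightarrow> partial_point f \<and> f top = top"
  by (auto simp: locale_map_def partial_point_def join_UNIV meet_UNIV one_UNIV)

text \<open>For compatible \<open>f\<close> and \<open>h\<close> this is the inverse image of the
  induced generalized point of the pullback, defined where both \<open>f\<close> and
  \<open>h\<close> are.\<close>

definition ev :: "('a \<Rightarrow> 'z::frame) \<Rightarrow> ('b \<Rightarrow> 'z) \<Rightarrow> ('a \<times> 'b) set \<Rightarrow> 'z" where
  "ev f h U = (SUP (a, b)\<in>U. inf (f a) (h b))"

lemma pairing_UNIV: "pairing UNIV f h U = ev f h U"
  by (auto simp: pairing_def ev_def join_UNIV meet_UNIV)

lemma ev_upper: "(a, b) \<in> U \<Longrightarrow> inf (f a) (h b) \<le> ev f h U"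
  unfolding ev_def by (rule SUP_upper2[of "(a, b)"]) auto

lemma ev_least: "(\<And>a b. (a, b) \<in> U \<Longrightarrow> inf (f a) (h b) \<le> z) \<Longrightarrow> ev f h U \<le> z"
  unfolding ev_def by (rule SUP_least) auto

lemma ev_mono: "U \<subseteq> V \<Longrightarrow> ev f h U \<le> ev f h V"
  unfolding ev_def by (rule SUP_subset_mono) auto

lemma partial_point_ev:
  "partial_point k \<Longrightarrow> k (ev f h U) = ev (\<lambda>a. k (f a)) (\<lambda>b. k (h b)) U"
  by (simp add: ev_def partial_point_Sup image_image case_prod_unfold partial_point_inf)

lemma inf_ev: "inf z (ev f h U) = ev (\<lambda>a. inf z (f a)) h U"
  by (simp add: ev_def inf_SUP_frame case_prod_unfold inf_assoc)

context pullback_frame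
begin

context
  fixes f :: "'a \<Rightarrow> 'z::frame" and h :: "'b \<Rightarrow> 'z"
  assumes f: "partial_point f"
    and h_join: "T \<subseteq> B \<Longrightarrow> h (join B T) = Sup (h ` T)"
    and h_meet: "x \<in> B \<Longrightarrow> y \<in> B \<Longrightarrow> h (meet B x y) = inf (h x) (h y)"
    and compat: "c \<in> C \<Longrightarrow> inf (f (F c)) (h (one B)) = inf (f top) (h (K c))"
begin

lemma h_mono: "x \<in> B \<Longrightarrow> y \<in> B \<Longrightarrow> x \<le> y \<Longrightarrow> h x \<le> h y"
proof -
  assume xy: "x \<in> B" "y \<in> B" "x \<le> y"
  then have "meet B x y = x"
    using le_meet_iff[OF carrier xy(1,2), of x] meet_le1[OF carrier xy(1,2)] by auto
  then show ?thesis using h_meet[OF xy(1,2)] by (metis inf.cobounded2)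
qed

text \<open>A join in \<open>P\<close> is a closure, so it can only be bounded by a member of
  \<open>P\<close>. These ideals are the members that bound it, which yields \<open>ev_join\<close>
  and \<open>ev_tensor\<close>.\<close>

lemma ev_ideal_in_pullback: "{(a, b). b \<in> B \<and> inf (f a) (h b) \<le> z} \<in> P"
proof (rule pullbackI)
  show "(a, b) \<in> {(a, b). b \<in> B \<and> inf (f a) (h b) \<le> z}"
    if "(a', b') \<in> {(a, b). b \<in> B \<and> inf (f a) (h b) \<le> z}" "b \<in> B" "a \<le> a'" "b \<le> b'" for a b a' b'
    using that partial_point_mono[OF f, of a a'] h_mono[of b b'] by (auto intro: order_trans inf_mono)
  show "(Sup S, b) \<in> {(a, b). b \<in> B \<and> inf (f a) (h b) \<le> z}"
    if "b \<in> B" "\<And>a. a \<in> S \<Longrightarrow> (a, b) \<in> {(a, b). b \<in> B \<and> inf (f a) (h b) \<le> z}" for S b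
    using that by (auto simp: partial_point_Sup[OF f] SUP_inf_frame intro: SUP_least)
  show "(a, join B T) \<in> {(a, b). b \<in> B \<and> inf (f a) (h b) \<le> z}"
    if "T \<subseteq> B" "\<And>b. b \<in> T \<Longrightarrow> (a, b) \<in> {(a, b). b \<in> B \<and> inf (f a) (h b) \<le> z}" for a T
    using that by (auto simp: h_join inf_SUP_frame join_in[OF carrier] intro: SUP_least)
  show "(inf a (F c), b) \<in> {(a, b). b \<in> B \<and> inf (f a) (h b) \<le> z} \<longleftrightarrow>
        (a, meet B b (K c)) \<in> {(a, b). b \<in> B \<and> inf (f a) (h b) \<le> z}"
    if bc: "b \<in> B" "c \<in> C" for a b c
  proof -
    have hb: "inf (h (one B)) (h b) = h b"
      using h_mono[OF bc(1) one_in[OF carrier] le_one[OF carrier bc(1)]] by (simp add: inf.absorb2)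
    have fa: "inf (f a) (f top) = f a" by (rule inf.absorb1) (rule partial_point_le_top[OF f])
    have "inf (f (inf a (F c))) (h b) = inf (inf (f a) (inf (f (F c)) (h (one B)))) (h b)"
      by (simp add: partial_point_inf[OF f] inf_assoc hb)
    also have "\<dots> = inf (inf (f a) (f top)) (inf (h b) (h (K c)))"
      by (simp add: compat[OF bc(2)] inf_assoc inf_commute inf_left_commute)
    also have "\<dots> = inf (f a) (h (meet B b (K c)))"
      using bc by (simp add: fa h_meet K_in)
    finally show ?thesis using bc by (auto simp: meet_in[OF carrier] K_in)
  qed
qed auto

lemma ev_join:
  assumes "\<S> \<subseteq> P"
  shows "ev f h (join P \<S>) = (SUP U\<in>\<S>. ev f h U)"
proof (rule antisym)
  let ?z = "SUP U\<in>\<S>. ev f h U"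
  have "U \<subseteq> {(a, b). b \<in> B \<and> inf (f a) (h b) \<le> ?z}" if "U \<in> \<S>" for U
    using that assms pullback_sub[of U] by (auto intro!: SUP_upper2[OF that] ev_upper)
  then have "join P \<S> \<subseteq> {(a, b). b \<in> B \<and> inf (f a) (h b) \<le> ?z}"
    using join_le_iff[OF pullback_carrier assms ev_ideal_in_pullback] by auto
  then show "ev f h (join P \<S>) \<le> ?z" by (auto intro: ev_least)
  show "?z \<le> ev f h (join P \<S>)"
    by (intro SUP_least ev_mono) (use join_upper[OF pullback_carrier assms] in auto)
qed

lemma ev_tensor:
  assumes "b \<in> B"
  shows "ev f h (tensor P a b) = inf (f a) (h b)"
proof (rule antisym)
  have "tensor P a b \<subseteq> {(x, y). y \<in> B \<and> inf (f x) (h y) \<le> inf (f a) (h b)}"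
    by (subst tensor_le_iff[OF assms ev_ideal_in_pullback]) (simp add: assms)
  then show "ev f h (tensor P a b) \<le> inf (f a) (h b)" by (auto intro: ev_least)
qed (rule ev_upper[OF tensor_mem[OF assms]])

lemma ev_one: "ev f h (UNIV \<times> B) = inf (f top) (h (one B))"
proof (rule antisym)
  show "ev f h (UNIV \<times> B) \<le> inf (f top) (h (one B))"
    by (rule ev_least)
       (simp add: le_infI1 le_infI2 h_mono one_in[OF carrier] le_one[OF carrier] partial_point_le_top[OF f])
qed (rule ev_upper, simp add: one_in[OF carrier])

lemma ev_Int:
  assumes "U \<in> P" "V \<in> P"
  shows "ev f h (U \<inter> V) = inf (ev f h U) (ev f h V)"
proof (rule antisym)
  have "inf (inf (f a) (h b)) (inf (f a') (h b')) \<le> ev f h (U \<inter> V)"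
    if "(a, b) \<in> U" "(a', b') \<in> V" for a b a' b'
  proof -
    have b: "b \<in> B" "b' \<in> B" using that assms pullback_sub by blast+
    then have "(inf a a', meet B b b') \<in> U \<inter> V"
      using that assms by (auto intro: pullback_down meet_in[OF carrier] meet_le1[OF carrier] meet_le2[OF carrier])
    from ev_upper[OF this, of f h] show ?thesis
      using b by (simp add: partial_point_inf[OF f] h_meet ac_simps)
  qed
  then show "inf (ev f h U) (ev f h V) \<le> ev f h (U \<inter> V)"
    by (auto simp: ev_def inf_SUP_frame SUP_inf_frame intro!: SUP_least)
qed (simp add: ev_mono)

text \<open>Turns the composites in the groupoid and action axioms into nested evaluations in one
  frame.\<close>

lemma ev_pairing:
  assumes "\<And>x y. (x, y) \<in> U \<Longrightarrow> q x \<in> P" "\<And>x y. (x, y) \<in> U \<Longrightarrow> q' y \<in> P"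
  shows "ev f h (pairing P q q' U) = ev (\<lambda>x. ev f h (q x)) (\<lambda>y. ev f h (q' y)) U"
proof -
  have "meet P (q x) (q' y) = q x \<inter> q' y" "ev f h (q x \<inter> q' y) = inf (ev f h (q x)) (ev f h (q' y))"
    if "(x, y) \<in> U" for x y
    using assms[OF that] by (simp_all add: meet_pullback ev_Int)
  moreover have "ev f h (pairing P q q' U) = (SUP z\<in>U. ev f h (case z of (x, y) \<Rightarrow> meet P (q x) (q' y)))"
    unfolding pairing_def
    by (subst ev_join) (auto simp: image_image intro!: meet_in[OF pullback_carrier] assms)
  ultimately show ?thesis
    unfolding ev_def[of "\<lambda>x. ev f h (q x)"] by (auto intro!: SUP_cong)
qed

end

end

lemma ev_cong:
  "(\<And>a b. (a, b) \<in> U \<Longrightarrow> inf (f a) (h b) = inf (f' a) (h' b)) \<Longrightarrow> ev f h U = ev f' h' U"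
  unfolding ev_def by (rule SUP_cong) auto

lemma ev_le_top: "partial_point f \<Longrightarrow> partial_point h \<Longrightarrow> ev f h U \<le> inf (f top) (h top)"
  by (rule ev_least, rule inf_mono) (simp_all add: partial_point_le_top)

text \<open>The anchors of \<open>f\<close> and \<open>h\<close> agree on the common domain
  \<open>inf (f top) (h top)\<close>; partial points need not preserve \<open>top\<close>.\<close>

definition composable ::
    "('o \<Rightarrow> 'a::frame) \<Rightarrow> ('o \<Rightarrow> 'b::frame) \<Rightarrow> ('a \<Rightarrow> 'z::frame) \<Rightarrow> ('b \<Rightarrow> 'z) \<Rightarrow> bool" where
  "composable F K f h \<longleftrightarrow> partial_point f \<and> partial_point h \<and>
     (\<forall>c. inf (f (F c)) (h top) = inf (f top) (h (K c)))"

interpretation PB: pullback_frame "UNIV :: 'b::frame set" "UNIV :: 'c set" F K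
  for F :: "'c \<Rightarrow> 'a::frame" and K
  by (rule pullback_frame_UNIV)

lemma PB_swap:
  "U \<in> pullback UNIV UNIV UNIV F K \<Longrightarrow> (inf (a :: 'a::frame) (F c), b :: 'b::frame) \<in> U \<longleftrightarrow> (a, inf b (K c)) \<in> U"
  using PB.pullback_swap[of U F K b c a] by (simp add: meet_UNIV)

lemma
  assumes "composable F K f h"
  shows PB_ev_join: "\<S> \<subseteq> pullback UNIV UNIV UNIV F K \<Longrightarrow>
          ev f h (join (pullback UNIV UNIV UNIV F K) \<S>) = (SUP U\<in>\<S>. ev f h U)"
    and PB_ev_tensor: "ev f h (tensor (pullback UNIV UNIV UNIV F K) a b) = inf (f a) (h b)"
    and PB_ev_one: "ev f h UNIV = inf (f top) (h top)"
    and PB_ev_Int: "U \<in> pullback UNIV UNIV UNIV F K \<Longrightarrow> V \<in> pullback UNIV UNIV UNIV F K \<Longrightarrow>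
          ev f h (U \<inter> V) = inf (ev f h U) (ev f h V)"
    and PB_ev_pairing:
      "(\<And>x. q x \<in> pullback UNIV UNIV UNIV F K) \<Longrightarrow> (\<And>y. q' y \<in> pullback UNIV UNIV UNIV F K) \<Longrightarrow>
          ev f h (pairing (pullback UNIV UNIV UNIV F K) q q' N) =
          ev (\<lambda>x. ev f h (q x)) (\<lambda>y. ev f h (q' y)) N"
proof -
  have fh: "partial_point f" "\<And>T. h (join UNIV T) = Sup (h ` T)"
    "\<And>x y. h (meet UNIV x y) = inf (h x) (h y)"
    "\<And>c. inf (f (F c)) (h (one UNIV)) = inf (f top) (h (K c))"
    using assms by (auto simp: composable_def join_UNIV meet_UNIV one_UNIV partial_point_Sup partial_point_inf)
  show "ev f h (tensor (pullback UNIV UNIV UNIV F K) a b) = inf (f a) (h b)"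
    using fh by (intro PB.ev_tensor) auto
  show "ev f h UNIV = inf (f top) (h top)"
    using PB.ev_one[of f h F K, OF fh] by (simp add: one_UNIV)
  show "\<S> \<subseteq> pullback UNIV UNIV UNIV F K \<Longrightarrow>
          ev f h (join (pullback UNIV UNIV UNIV F K) \<S>) = (SUP U\<in>\<S>. ev f h U)"
    using fh by (intro PB.ev_join) auto
  show "U \<in> pullback UNIV UNIV UNIV F K \<Longrightarrow> V \<in> pullback UNIV UNIV UNIV F K \<Longrightarrow>
          ev f h (U \<inter> V) = inf (ev f h U) (ev f h V)"
    using fh by (intro PB.ev_Int) auto
  show "(\<And>x. q x \<in> pullback UNIV UNIV UNIV F K) \<Longrightarrow> (\<And>y. q' y \<in> pullback UNIV UNIV UNIV F K) \<Longrightarrow>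
          ev f h (pairing (pullback UNIV UNIV UNIV F K) q q' N) =
          ev (\<lambda>x. ev f h (q x)) (\<lambda>y. ev f h (q' y)) N"
    using fh by (intro PB.ev_pairing) auto
qed

section \<open>Actions in terms of generalized points\<close>

locale groupoid_action =
  fixes G :: "('o::frame, 'g::frame) groupoid"
    and p :: "'o \<Rightarrow> 'x::frame"
    and \<alpha> :: "'x \<Rightarrow> ('g \<times> 'x) set"
  assumes groupoid: "localic_groupoid G" and action: "G_locale G p \<alpha>"
begin

lemma
  shows partial_point_d: "partial_point (gd G)" and d_top: "gd G top = top"
    and partial_point_r: "partial_point (gr G)" and r_top: "gr G top = top"
    and partial_point_u: "partial_point (gu G)" and u_top: "gu G top = top"
    and partial_point_i: "partial_point (gi G)" and i_top: "gi G top = top"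
    and partial_point_p: "partial_point p" and p_top: "p top = top"
    and u_d: "gu G (gd G c) = c" and u_r: "gu G (gr G c) = c"
    and i_d: "gi G (gd G c) = gr G c" and i_r: "gi G (gr G c) = gd G c"
    and m_r: "gm G (gr G c) = G2_\<pi>2 G (gr G c)"
    and left_unit: "ev (\<lambda>a. gd G (gu G a)) id (gm G c') = c'"
    and right_unit: "ev id (\<lambda>a. gr G (gu G a)) (gm G c') = c'"
    and left_inverse: "ev (gi G) id (gm G c') = gr G (gu G c')"
  using groupoid action
  unfolding localic_groupoid_def G_locale_def locale_map_UNIV_iff
  by (auto simp: fun_eq_iff pairing_UNIV o_def id_def)

lemma
  shows act_map: "locale_map (GX G p) UNIV \<alpha>"
    and act_p: "\<alpha> (p c) = GX_\<pi>1 G p (gd G c)"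
    and act_unit: "ev (\<lambda>a. p (gu G a)) id (\<alpha> x) = x"
  using action unfolding G_locale_def
  by (auto simp: fun_eq_iff pairing_UNIV o_def id_def)

lemma act_in: "\<alpha> x \<in> GX G p"
  using act_map by (auto simp: locale_map_def)

lemma act_Sup: "\<alpha> (Sup S) = join (GX G p) (\<alpha> ` S)"
  using act_map by (simp add: locale_map_def join_UNIV)

lemma act_inf: "\<alpha> (inf x y) = \<alpha> x \<inter> \<alpha> y"
  using act_map act_in
  by (simp add: locale_map_def meet_UNIV PB.meet_pullback[of _ "gr G" p, folded GX_def])

lemma act_top: "\<alpha> top = UNIV"
  using act_map by (simp add: locale_map_def one_UNIV PB.one_pullback[of "gr G" p, folded GX_def])

text \<open>
  The two sides are \<open>f \<cdot> (g \<cdot> h)\<close> and \<open>(f g) \<cdot> h\<close> for generalized elements \<open>f, g\<close> of \<open>G\<^sub>1\<close> and \<open>h\<close> of \<open>X\<close>.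
\<close>

lemma act_assoc:
  assumes fg: "composable (gr G) (gd G) f g" and gh: "composable (gr G) p g h"
  shows "ev f (\<lambda>y. ev g h (\<alpha> y)) (\<alpha> x) = ev (\<lambda>c. ev f g (gm G c)) h (\<alpha> x)"
proof -
  interpret T: pullback_frame "GX G p" UNIV "gr G" "GX_\<pi>1 G p \<circ> gd G"
    by standard (simp_all add: GX_def PB.pullback_carrier PB.proj1_in)
  have GGX: "GGX G p = T.P" by (simp add: GGX_def)
  have pp: "partial_point f" "partial_point g" "partial_point h"
    using fg gh by (auto simp: composable_def)
  let ?H = "ev g h" and ?\<pi>1 = "proj1 (GGX G p) (GX G p)" and ?\<pi>2 = "proj2 (GGX G p) UNIV"
  \<comment> \<open>\<open>?k\<close> evaluates at the generalized point (f, (g, h)) of the triple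
    product. Applying it to both composites of the associativity axiom gives the two sides.\<close>
  let ?k = "ev f ?H"
  note gh' = gh[unfolded composable_def]
  have tens: "?H (tensor (GX G p) a y) = inf (g a) (h y)" for a y
    unfolding GX_def by (rule PB_ev_tensor[OF gh])
  have one: "one (GX G p) = UNIV" "?H UNIV = inf (g top) (h top)"
    using PB_ev_one[OF gh] by (simp_all add: GX_def PB.one_pullback)
  have p1: "?H (GX_\<pi>1 G p a) = inf (g a) (h top)" and p2: "?H (GX_\<pi>2 G p y) = inf (g top) (h y)" for a y
    by (simp_all add: proj1_def proj2_def one_UNIV tens)
  have pp1: "GX_\<pi>1 G p a \<in> GX G p" and pp2: "GX_\<pi>2 G p y \<in> GX G p" for a y
    by (simp_all add: GX_def PB.proj1_in PB.proj2_in)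
  have H: "\<And>T. T \<subseteq> GX G p \<Longrightarrow> ?H (join (GX G p) T) = Sup (?H ` T)"
     "\<And>U V. U \<in> GX G p \<Longrightarrow> V \<in> GX G p \<Longrightarrow> ?H (meet (GX G p) U V) = inf (?H U) (?H V)"
     "\<And>c. inf (f (gr G c)) (?H (one (GX G p))) = inf (f top) (?H ((GX_\<pi>1 G p \<circ> gd G) c))"
  proof -
    show "T \<subseteq> GX G p \<Longrightarrow> ?H (join (GX G p) T) = Sup (?H ` T)" for T
      unfolding GX_def by (rule PB_ev_join[OF gh])
    show "U \<in> GX G p \<Longrightarrow> V \<in> GX G p \<Longrightarrow> ?H (meet (GX G p) U V) = inf (?H U) (?H V)" for U V
      unfolding GX_def by (simp add: PB.meet_pullback PB_ev_Int[OF gh])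
    show "inf (f (gr G c)) (?H (one (GX G p))) = inf (f top) (?H ((GX_\<pi>1 G p \<circ> gd G) c))" for c
      using fg by (simp add: one p1 composable_def flip: inf_assoc)
  qed
  note k = T.ev_pairing[OF pp(1) H, folded GGX] T.ev_tensor[OF pp(1) H, folded GGX]
  have k1: "?k (?\<pi>1 a) = inf (f a) (inf (g top) (h top))" for a
    unfolding proj1_def using one_in[OF T.carrier] by (subst k(2)) (simp_all add: one)
  have k2: "?k (?\<pi>2 U) = inf (f top) (?H U)" if "U \<in> GX G p" for U
    unfolding proj2_def by (subst k(2)) (simp_all add: one_UNIV that)
  have in1: "?\<pi>1 a \<in> GGX G p" for a by (simp add: GGX T.proj1_in)
  have in2: "?\<pi>2 U \<in> GGX G p" if "U \<in> GX G p" for U using that by (simp add: GGX T.proj2_in)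
  have f_top: "inf (f a) (f top) = f a" for a
    by (rule inf.absorb1) (rule partial_point_le_top[OF pp(1)])
  let ?q = "\<lambda>c. pairing (GGX G p) ?\<pi>1 (?\<pi>2 \<circ> GX_\<pi>1 G p) (gm G c)"
  have q_in: "?q c \<in> GGX G p" for c
    unfolding GGX by (rule T.pairing_in) (simp_all add: in1 in2 pp1 flip: GGX)
  have "?k (?q c) = ev (\<lambda>a. inf (f a) (inf (g top) (h top))) (\<lambda>b. inf (f top) (inf (g b) (h top))) (gm G c)" for c
    by (subst k(1)) (simp_all add: in1 in2 pp1 k1 k2 p1)
  \<comment> \<open>The values at \<open>top\<close> only record domains of definition; all but
    \<open>h top\<close> lie above another factor and are absorbed.\<close>
  also have "\<dots> c = ev (\<lambda>a. inf (h top) (f a)) g (gm G c)" for c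
  proof (rule ev_cong)
    fix a b
    have "inf (g top) (g b) = g b" by (rule inf.absorb2) (rule partial_point_le_top[OF pp(2)])
    then show "inf (inf (f a) (inf (g top) (h top))) (inf (f top) (inf (g b) (h top))) =
        inf (inf (h top) (f a)) (g b)"
      using f_top[of a] by (simp add: ac_simps) (metis inf_left_commute inf_commute)
  qed
  also have "\<dots> c = inf (h top) (ev f g (gm G c))" for c
    by (simp add: inf_ev)
  finally have kq: "?k (?q c) = inf (h top) (ev f g (gm G c))" for c .
  have "?k (pairing (GGX G p) ?\<pi>1 (?\<pi>2 \<circ> \<alpha>) (\<alpha> x)) =
      ev (\<lambda>a. inf (f a) (inf (g top) (h top))) (\<lambda>y. inf (f top) (?H (\<alpha> y))) (\<alpha> x)"
    by (subst k(1)) (simp_all add: in1 in2 act_in k1 k2)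
  also have "\<dots> = ev f (\<lambda>y. ?H (\<alpha> y)) (\<alpha> x)"
  proof (rule ev_cong)
    fix a y
    have "inf (inf (g top) (h top)) (?H (\<alpha> y)) = ?H (\<alpha> y)"
      by (rule inf.absorb2) (rule ev_le_top[OF pp(2,3)])
    moreover have "inf (inf (f a) (inf (g top) (h top))) (inf (f top) (?H (\<alpha> y))) =
        inf (inf (f a) (f top)) (inf (inf (g top) (h top)) (?H (\<alpha> y)))"
      by (simp add: ac_simps)
    ultimately show "inf (inf (f a) (inf (g top) (h top))) (inf (f top) (?H (\<alpha> y))) = inf (f a) (?H (\<alpha> y))"
      by (simp only: f_top)
  qed
  finally have L: "?k (pairing (GGX G p) ?\<pi>1 (?\<pi>2 \<circ> \<alpha>) (\<alpha> x)) = ev f (\<lambda>y. ?H (\<alpha> y)) (\<alpha> x)" .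
  have "?k (pairing (GGX G p) ?q (?\<pi>2 \<circ> GX_\<pi>2 G p) (\<alpha> x)) =
      ev (\<lambda>c. inf (h top) (ev f g (gm G c))) (\<lambda>y. inf (f top) (inf (g top) (h y))) (\<alpha> x)"
    by (subst k(1)) (simp_all add: q_in in2 pp2 k2 p2 kq)
  also have "\<dots> = ev (\<lambda>c. ev f g (gm G c)) h (\<alpha> x)"
  proof (rule ev_cong)
    fix c y
    have "inf (inf (f top) (g top)) (ev f g (gm G c)) = ev f g (gm G c)"
      by (rule inf.absorb2) (rule ev_le_top[OF pp(1,2)])
    moreover have "inf (h top) (h y) = h y" by (rule inf.absorb2) (rule partial_point_le_top[OF pp(3)])
    moreover have "inf (inf (h top) (ev f g (gm G c))) (inf (f top) (inf (g top) (h y))) =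
        inf (inf (inf (f top) (g top)) (ev f g (gm G c))) (inf (h top) (h y))"
      by (simp add: ac_simps)
    ultimately show "inf (inf (h top) (ev f g (gm G c))) (inf (f top) (inf (g top) (h y))) =
        inf (ev f g (gm G c)) (h y)"
      by (simp only:)
  qed
  finally have R: "?k (pairing (GGX G p) ?q (?\<pi>2 \<circ> GX_\<pi>2 G p) (\<alpha> x)) = ev (\<lambda>c. ev f g (gm G c)) h (\<alpha> x)" .
  have "pairing (GGX G p) ?\<pi>1 (?\<pi>2 \<circ> \<alpha>) (\<alpha> x) = pairing (GGX G p) ?q (?\<pi>2 \<circ> GX_\<pi>2 G p) (\<alpha> x)"
    using action unfolding G_locale_def Let_def by (auto simp: fun_eq_iff o_def)
  then show ?thesis using L R by simp
qed

end

text \<open>Left multiplication is an action with anchor \<open>gd G\<close>, so results on actions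
  specialise to products in the quantale.\<close>

lemma groupoid_action_self:
  assumes "localic_groupoid G"
  shows "groupoid_action G (gd G) (gm G)"
proof
  show "localic_groupoid G" by fact
  show "G_locale G (gd G) (gm G)"
    using assms unfolding localic_groupoid_def G_locale_def Let_def G2_def G3_def GX_def GGX_def
    by blast
qed

text \<open>Not an axiom: associativity at the triple ((g^-1)^-1, g^-1, g) has two bracketings,
  which reduce to (g^-1)^-1 and to g.\<close>

lemma inverse_involutive:
  fixes G :: "('o::frame, 'g::frame) groupoid"
  assumes "localic_groupoid G"
  shows "gi G (gi G x) = x"
proof -
  interpret groupoid_action G "gd G" "gm G" by (rule groupoid_action_self[OF assms])
  let ?ii = "\<lambda>a. gi G (gi G a)"
  have ii: "partial_point ?ii"
    using partial_point_comp[OF partial_point_i partial_point_i] by (simp add: o_def)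
  have "composable (gr G) (gd G) ?ii (gi G)" "composable (gr G) (gd G) (gi G) id"
    by (auto simp: composable_def ii partial_point_i partial_point_id i_top i_d i_r)
  moreover have "ev ?ii (gi G) U = gi G (ev (gi G) id U)" for U
    by (simp add: partial_point_ev[OF partial_point_i])
  ultimately
  have "ev ?ii (\<lambda>y. gr G (gu G y)) (gm G x) = ev (\<lambda>c. gi G (ev (gi G) id (gm G c))) id (gm G x)"
    using act_assoc[of ?ii "gi G" id x] by (simp add: left_inverse)
  also have "\<dots> = x" by (simp add: left_inverse i_r left_unit)
  also have "ev ?ii (\<lambda>y. gr G (gu G y)) (gm G x) = ?ii (ev id (\<lambda>y. gr G (gu G y)) (gm G x))"
    by (simp add: partial_point_ev[OF ii] i_d i_r)
  finally show ?thesis by (simp add: right_unit)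
qed

section \<open>Local homeomorphisms and their sections\<close>

text \<open>An equational notion of section that serves \<open>gd G\<close>, \<open>gr G\<close>,
  \<open>p\<close> and the orbit map alike.\<close>

definition section_of :: "'b::order set \<Rightarrow> ('b \<Rightarrow> 'a::frame) \<Rightarrow> 'a \<Rightarrow> bool" where
  "section_of B f s \<longleftrightarrow> (\<forall>x\<le>s. inf s (f (direct_image B f x)) = x)"

lemma section_ofD: "section_of B f s \<Longrightarrow> x \<le> s \<Longrightarrow> inf s (f (direct_image B f x)) = x"
  by (simp add: section_of_def)

lemma
  assumes "open_map UNIV B f"
  shows open_map_image_in: "direct_image B f x \<in> B"
    and open_map_adjoint: "y \<in> B \<Longrightarrow> direct_image B f x \<le> y \<longleftrightarrow> x \<le> f y"
    and open_map_frobenius: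
      "y \<in> B \<Longrightarrow> direct_image B f (inf (x :: 'a::frame) (f y)) = meet B (direct_image B f x) y"
  using assms by (auto simp: open_map_def is_left_adjoint_def meet_UNIV)

text \<open>By Frobenius the restricted direct image is always onto, so only the recovery of
  \<open>x\<close> from its image is at stake.\<close>

lemma order_iso_iff_section_of:
  fixes f :: "'b::order \<Rightarrow> 'a::frame"
  assumes f: "open_map UNIV B f"
  shows "order_iso (down UNIV s) (down B (direct_image B f s)) (direct_image B f) \<longleftrightarrow> section_of B f s"
proof
  let ?h = "direct_image B f"
  note adj = open_map_adjoint[OF f] and h_in = open_map_image_in[OF f]
  have unit: "x \<le> f (?h x)" for x using adj[OF h_in] by blast
  have h_mono: "?h x \<le> ?h y" if "x \<le> y" for x y
    using adj[OF h_in] unit[of y] that by (auto intro: order_trans)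
  show "section_of B f s" if iso: "order_iso (down UNIV s) (down B (?h s)) ?h"
    unfolding section_of_def
  proof (intro allI impI antisym)
    fix x assume x: "x \<le> s"
    let ?z = "inf s (f (?h x))"
    have "?h ?z \<le> ?h x" by (simp add: adj h_in)
    then show "?z \<le> x" using iso x by (simp add: order_iso_def down_def)
    show "x \<le> ?z" using x unit by simp
  qed
  show "order_iso (down UNIV s) (down B (?h s)) ?h" if s: "section_of B f s"
  proof -
    have f_mono: "f y \<le> f y'" if "y \<in> B" "y' \<in> B" "y \<le> y'" for y y'
      using that adj by (meson order_refl order_trans)
    have le: "?h x \<le> ?h y \<longleftrightarrow> x \<le> y" if "x \<le> s" "y \<le> s" for x y
    proof
      assume "?h x \<le> ?h y"
      then have "inf s (f (?h x)) \<le> inf s (f (?h y))" by (intro inf_mono f_mono h_in) auto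
      then show "x \<le> y" using section_ofD[OF s] that by simp
    qed (rule h_mono)
    have "inj_on ?h (down UNIV s)"
      by (rule inj_onI) (simp add: down_def, metis antisym le order_refl)
    moreover have "?h ` down UNIV s = down B (?h s)"
    proof (intro subset_antisym subsetI)
      fix y assume y: "y \<in> down B (?h s)"
      have "meet B (?h s) y = y"
        unfolding meet_def by (rule Greatest_equality) (use y in \<open>auto simp: down_def\<close>)
      then have "y = ?h (inf s (f y))" using y open_map_frobenius[OF f] by (simp add: down_def)
      then show "y \<in> ?h ` down UNIV s" by (auto simp: down_def)
    qed (auto simp: down_def h_in h_mono)
    ultimately show ?thesis using le by (auto simp: order_iso_def bij_betw_def down_def)
  qed
qed

lemma section_of_down:
  assumes f: "open_map UNIV B f" and s: "section_of B f s" and "t \<le> s"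
  shows "section_of B f t"
  unfolding section_of_def
proof (intro allI impI antisym)
  fix x assume "x \<le> t"
  have "inf s (f (direct_image B f x)) = x" using s \<open>x \<le> t\<close> \<open>t \<le> s\<close> by (meson section_ofD order_trans)
  then show "inf t (f (direct_image B f x)) \<le> x" using \<open>t \<le> s\<close> by (metis inf_mono order_refl)
  show "x \<le> inf t (f (direct_image B f x))"
    using \<open>x \<le> t\<close> open_map_adjoint[OF f open_map_image_in[OF f]] by auto
qed

lemma section_of_cover:
  assumes "local_homeomorphism UNIV B f"
  shows "Sup {s. section_of B f s} = top"
proof -
  obtain S where om: "open_map UNIV B f" and S: "Sup S = top"
    "\<forall>s\<in>S. order_iso (down UNIV s) (down B (direct_image B f s)) (direct_image B f)"
    using assms by (auto simp: local_homeomorphism_def join_UNIV one_UNIV)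
  then have "Sup S \<le> Sup {s. section_of B f s}"
    using order_iso_iff_section_of[OF om] by (intro Sup_subset_mono) auto
  then show ?thesis using S by (simp add: top_unique)
qed

lemma dense_if_cover:
  fixes x :: "'a::frame"
  assumes cover: "Sup {s. Q s} = top" and down: "\<And>s t. Q s \<Longrightarrow> t \<le> s \<Longrightarrow> Q t"
  shows "Sup {s. Q s \<and> s \<le> x} = x"
proof (rule antisym)
  have "x = (SUP s\<in>{s. Q s}. inf x s)"
    using inf_Sup_frame[of x "{s. Q s}"] by (simp add: cover)
  also have "\<dots> \<le> Sup {s. Q s \<and> s \<le> x}"
    by (rule SUP_least) (auto intro!: Sup_upper elim: down)
  finally show "x \<le> Sup {s. Q s \<and> s \<le> x}" .
qed (auto intro: Sup_least)

abbreviation img :: "('b::order \<Rightarrow> 'a::order) \<Rightarrow> 'a \<Rightarrow> 'b" where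
  "img \<equiv> direct_image UNIV"

lemma direct_image_eqI: "(\<And>y. z \<le> y \<longleftrightarrow> x \<le> f y) \<Longrightarrow> img f x = z"
  unfolding direct_image_def by (rule Least_equality) auto

lemma local_homeomorphismI:
  fixes f :: "'b::frame \<Rightarrow> 'a::frame"
  assumes f: "partial_point f" "f top = top"
    and adj: "\<And>x y. g x \<le> y \<longleftrightarrow> x \<le> f y"
    and frob: "\<And>x y. g (inf x (f y)) = inf (g x) y"
    and cover: "Sup {s. \<forall>x\<le>s. inf s (f (g x)) = x} = top"
  shows "local_homeomorphism UNIV UNIV f"
proof -
  have g: "img f x = g x" for x by (rule direct_image_eqI) (rule adj)
  have om: "open_map UNIV UNIV f"
    using f by (simp add: open_map_def is_left_adjoint_def locale_map_UNIV_iff g adj frob meet_UNIV)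
  have "Sup {s. section_of UNIV f s} = top" using cover by (simp add: section_of_def g)
  then show ?thesis
    unfolding local_homeomorphism_def
    using om order_iso_iff_section_of[OF om]
    by (intro conjI exI[of _ "{s. section_of UNIV f s}"]) (auto simp: join_UNIV one_UNIV)
qed

locale local_homeo =
  fixes f :: "'b::frame \<Rightarrow> 'a::frame"
  assumes local_homeomorphism: "local_homeomorphism UNIV UNIV f"
begin

lemma open_map: "open_map UNIV UNIV f"
  using local_homeomorphism by (simp add: local_homeomorphism_def)

lemma partial_point: "partial_point f"
  using open_map by (simp add: open_map_def locale_map_UNIV_iff)

lemmas mono = partial_point_mono[OF partial_point]

lemma adjoint: "img f x \<le> y \<longleftrightarrow> x \<le> f y"
  and frobenius: "img f (inf x (f y)) = inf (img f x) y"
  using open_map_adjoint[OF open_map, of y x] open_map_frobenius[OF open_map, of y x]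
  by (simp_all add: meet_UNIV)

lemma unit: "x \<le> f (img f x)"
  using adjoint by blast

lemma img_mono: "x \<le> y \<Longrightarrow> img f x \<le> img f y"
  by (meson adjoint unit order_trans)

lemma img_Sup: "img f (Sup S) = (SUP x\<in>S. img f x)"
proof (rule antisym)
  have "x \<le> f (SUP x\<in>S. img f x)" if "x \<in> S" for x
    using mono[OF SUP_upper[OF that]] unit by (rule order_trans[rotated])
  then show "img f (Sup S) \<le> (SUP x\<in>S. img f x)" by (simp add: adjoint Sup_least)
qed (auto intro!: SUP_least img_mono Sup_upper)

abbreviation is_section :: "'a \<Rightarrow> bool" where
  "is_section \<equiv> section_of UNIV f"

lemmas section_down = section_of_down[OF open_map]

text \<open>Below a section the direct image is an isomorphism, hence preserves meets. This makes
  \<open>pt v\<close> a partial point.\<close>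

lemma img_inf_section:
  assumes "is_section s"
  shows "img f (inf s (inf a b)) = inf (img f (inf s a)) (img f (inf s b))"
proof -
  have "inf s (f (img f (inf s a))) = inf s a" using assms by (rule section_ofD) simp
  then have "inf s (inf a b) = inf (inf s b) (f (img f (inf s a)))"
    by (metis inf_assoc inf_commute)
  then show ?thesis by (simp add: frobenius inf_commute)
qed

lemmas sections_cover = section_of_cover[OF local_homeomorphism]

lemma sections_dense: "Sup {s. is_section s \<and> s \<le> x} = x"
  by (rule dense_if_cover[OF sections_cover]) (rule section_down)

end


section \<open>Bisections and their action\<close>

locale etale_action =
  fixes G :: "('o::frame, 'g::frame) groupoid"
    and p :: "'o \<Rightarrow> 'x::frame"
    and \<alpha> :: "'x \<Rightarrow> ('g \<times> 'x) set"
  assumes etale: "etale_groupoid G" and sheaf: "G_sheaf G p \<alpha>"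
begin

sublocale groupoid_action G p \<alpha>
  using etale sheaf by unfold_locales (auto simp: etale_groupoid_def G_sheaf_def)

lemma i_i: "gi G (gi G a) = a"
  by (rule inverse_involutive[OF groupoid])

sublocale P: local_homeo p
  using sheaf by unfold_locales (simp add: G_sheaf_def)

sublocale D: local_homeo "gd G"
  using etale by unfold_locales (simp add: etale_groupoid_def)

lemma i_le_iff: "gi G a \<le> b \<longleftrightarrow> a \<le> gi G b"
  by (metis i_i partial_point_mono[OF partial_point_i])

lemma img_i: "img (gi G) a = gi G a"
  by (rule direct_image_eqI) (rule i_le_iff)

lemma i_inf: "gi G (inf a b) = inf (gi G a) (gi G b)"
  by (rule partial_point_inf[OF partial_point_i])

lemma img_r: "img (gr G) a = img (gd G) (gi G a)"
  by (rule direct_image_eqI) (simp add: D.adjoint i_le_iff i_d)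

text \<open>Inversion exchanges the domain and range maps, so inverses of sections of
  \<open>gd G\<close> are sections of \<open>gr G\<close>, and they still cover.\<close>

sublocale R: local_homeo "gr G"
proof (unfold_locales, rule local_homeomorphismI)
  show "img (gd G) (gi G a) \<le> b \<longleftrightarrow> a \<le> gr G b" for a b
    by (simp add: D.adjoint i_le_iff i_d)
  show "img (gd G) (gi G (inf a (gr G b))) = inf (img (gd G) (gi G a)) b" for a b
    by (simp add: i_inf i_r D.frobenius)
  have "\<forall>a\<le>gi G s. inf (gi G s) (gr G (img (gd G) (gi G a))) = a" if s: "D.is_section s" for s
  proof (intro allI impI)
    fix a assume "a \<le> gi G s"
    then have "inf s (gd G (img (gd G) (gi G a))) = gi G a"
      using s by (intro section_ofD[OF s]) (simp add: i_le_iff)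
    then have "gi G (inf s (gd G (img (gd G) (gi G a)))) = a" by (simp add: i_i)
    then show "inf (gi G s) (gr G (img (gd G) (gi G a))) = a" by (simp add: i_inf i_d)
  qed
  then have "gi G ` {s. D.is_section s} \<subseteq> {s. \<forall>a\<le>s. inf s (gr G (img (gd G) (gi G a))) = a}"
    by auto
  then have "Sup (gi G ` {s. D.is_section s}) \<le> Sup {s. \<forall>a\<le>s. inf s (gr G (img (gd G) (gi G a))) = a}"
    by (rule Sup_subset_mono)
  moreover have "Sup (gi G ` {s. D.is_section s}) = top"
    using partial_point_Sup[OF partial_point_i, of "{s. D.is_section s}"]
    by (simp add: D.sections_cover i_top)
  ultimately show "Sup {s. \<forall>a\<le>s. inf s (gr G (img (gd G) (gi G a))) = a} = top"
    by (simp add: top_unique)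
qed (auto simp: partial_point_r r_top)

lemma img_d: "img (gd G) a = img (gr G) (gi G a)"
  by (simp add: img_r i_i)

lemma section_i: "R.is_section (gi G v) \<longleftrightarrow> D.is_section v"
proof -
  have "R.is_section (gi G v) \<longleftrightarrow> (\<forall>a. a \<le> gi G v \<longrightarrow> inf (gi G v) (gr G (img (gd G) (gi G a))) = a)"
    by (simp add: section_of_def img_r)
  also have "\<dots> \<longleftrightarrow> (\<forall>a. gi G a \<le> gi G v \<longrightarrow> inf (gi G v) (gr G (img (gd G) a)) = gi G a)"
    by (metis i_i)
  also have "\<dots> \<longleftrightarrow> (\<forall>a. a \<le> v \<longrightarrow> inf v (gd G (img (gd G) a)) = a)"
    by (metis i_le_iff i_i i_inf i_d)
  finally show ?thesis by (simp add: section_of_def)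
qed

abbreviation e :: 'g where "e \<equiv> qunit G"

text \<open>
  Over a section \<open>s\<close> of \<open>d\<close>, the unit section agrees with \<open>s\<close> exactly on \<open>u\<^sup>* s\<close>; gluing these pieces gives
  the open set of units.
\<close>

lemma
  shows unit_adjoint: "img (gu G) o' \<le> a \<longleftrightarrow> o' \<le> gu G a"
    and img_u: "img (gu G) o' = inf e (gd G o')"
    and u_unit: "gu G e = top"
    and unit_inf: "inf e a = inf e (gd G (gu G a))"
proof -
  let ?S = "{s. D.is_section s}"
  let ?e = "SUP s\<in>?S. inf s (gd G (gu G s))"
  note u_inf = partial_point_inf[OF partial_point_u] and u_mono = partial_point_mono[OF partial_point_u]
  have "gu G ?e = (SUP s\<in>?S. gu G s)"
    by (simp add: partial_point_Sup[OF partial_point_u] image_image u_inf u_d)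
  also have "\<dots> = top"
    using D.sections_cover u_top by (metis partial_point_Sup[OF partial_point_u])
  finally have ue: "gu G ?e = top" .
  have key: "inf (inf s (gd G (gu G s))) (gd G o') \<le> a"
    if s: "D.is_section s" and o': "o' \<le> gu G a" for s o' a
  proof -
    have as: "inf s (gd G (img (gd G) (inf a s))) = inf a s"
      by (rule section_ofD[OF s]) simp
    then have "gu G (inf a s) \<le> img (gd G) (inf a s)"
      using u_mono[of "inf a s" "gd G (img (gd G) (inf a s))"] by (metis inf.cobounded2 u_d)
    then have "inf (gu G s) o' \<le> img (gd G) (inf a s)"
      using o' by (metis inf_mono inf_commute order_refl order_trans u_inf)
    then have "inf s (gd G (inf (gu G s) o')) \<le> inf a s"
      using as D.mono by (metis inf_mono order_refl)
    then show ?thesis by (simp add: partial_point_inf[OF partial_point_d] inf_assoc)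
  qed
  have adj: "inf ?e (gd G o') \<le> a \<longleftrightarrow> o' \<le> gu G a" for o' a
  proof
    assume "inf ?e (gd G o') \<le> a"
    from u_mono[OF this] show "o' \<le> gu G a" by (simp add: u_inf ue u_d)
  next
    assume "o' \<le> gu G a"
    then show "inf ?e (gd G o') \<le> a" by (auto simp: SUP_inf_frame intro!: SUP_least key)
  qed
  have img: "img (gu G) o' = inf ?e (gd G o')" for o'
    by (rule direct_image_eqI) (rule adj)
  have e: "e = ?e" unfolding qunit_def by (simp add: img d_top)
  show "img (gu G) o' \<le> a \<longleftrightarrow> o' \<le> gu G a" by (simp add: img adj)
  show "img (gu G) o' = inf e (gd G o')" by (simp add: img e)
  show "gu G e = top" by (simp add: e ue)
  have "inf (inf s (gd G (gu G s))) a \<le> gd G (gu G a)" if s: "D.is_section s" for s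
  proof -
    let ?x = "inf s (gd G (gu G s))"
    let ?o = "img (gd G) (inf ?x a)"
    have xa: "inf ?x (gd G ?o) = inf ?x a"
      by (rule section_ofD[OF D.section_down[OF s inf.cobounded1]]) (rule inf.cobounded1)
    have "?o \<le> gu G s" by (simp add: D.adjoint inf.coboundedI1)
    then have "?o = gu G (inf ?x (gd G ?o))" by (simp add: u_inf u_d inf.absorb2)
    then have "?o \<le> gu G a" by (metis xa inf.cobounded2 u_mono)
    then show ?thesis by (metis xa D.mono inf.coboundedI2)
  qed
  then have "inf ?e a \<le> gd G (gu G a)" by (auto simp: SUP_inf_frame intro: SUP_least)
  moreover have "inf ?e (gd G (gu G a)) \<le> a" by (simp add: adj)
  ultimately show "inf e a = inf e (gd G (gu G a))" by (auto simp: e intro: antisym)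
qed

lemma unit_inf_r: "inf e (gr G c) = inf e (gd G c)"
  using unit_inf[of "gr G c"] by (simp add: u_r)

lemma unit_le_r: "b \<le> e \<Longrightarrow> b = inf e (gr G (gu G b))"
  using unit_inf[of b] unit_inf_r by (simp add: inf.absorb2)

definition bisection :: "'g \<Rightarrow> bool" where
  "bisection v \<longleftrightarrow> D.is_section v \<and> R.is_section v"

lemma bisectionD: "bisection v \<Longrightarrow> D.is_section v" "bisection v \<Longrightarrow> R.is_section v"
  by (auto simp: bisection_def)

lemma bisection_down: "bisection v \<Longrightarrow> w \<le> v \<Longrightarrow> bisection w"
  by (auto simp: bisection_def elim: D.section_down R.section_down)

lemma bisection_i: "bisection v \<Longrightarrow> bisection (gi G v)"
  using section_i[of v] section_i[of "gi G v"] by (auto simp: bisection_def i_i)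

lemma bisection_unit: "bisection e"
proof -
  have "inf e (gd G (img (gd G) a)) = a" "inf e (gr G (img (gr G) a)) = a" if "a \<le> e" for a
  proof -
    have a: "a = inf e (gd G (gu G a))" "a = inf e (gr G (gu G a))"
      using that unit_inf[of a] unit_le_r by (simp_all add: inf.absorb2)
    then have "img (gd G) a \<le> gu G a" "img (gr G) a \<le> gu G a"
      by (metis D.adjoint inf.cobounded2, metis R.adjoint inf.cobounded2)
    then show "inf e (gd G (img (gd G) a)) = a" "inf e (gr G (img (gr G) a)) = a"
      using a that D.mono R.mono D.unit R.unit
      by (auto intro!: antisym) (metis inf_mono order_refl)+
  qed
  then show ?thesis by (simp add: bisection_def section_of_def)
qed

text \<open>Sections of both maps are closed downwards, so a cover by sections of
  \<open>gd G\<close> is refined by sections of \<open>gr G\<close>.\<close>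

lemma bisections_dense: "Sup {v. bisection v \<and> v \<le> a} = a"
proof (rule antisym)
  have "a = Sup {v. D.is_section v \<and> v \<le> a}" by (simp add: D.sections_dense)
  also have "\<dots> \<le> Sup {v. bisection v \<and> v \<le> a}"
  proof (rule Sup_least, clarify)
    fix v assume v: "D.is_section v" "v \<le> a"
    have "v = Sup {w. R.is_section w \<and> w \<le> v}" by (simp add: R.sections_dense)
    also have "\<dots> \<le> Sup {v. bisection v \<and> v \<le> a}"
      by (rule Sup_subset_mono) (use v D.section_down in \<open>auto simp: bisection_def\<close>)
    finally show "v \<le> Sup {v. bisection v \<and> v \<le> a}" .
  qed
  finally show "a \<le> Sup {v. bisection v \<and> v \<le> a}" .
qed (auto intro: Sup_least)

text \<open>The generalized element \<open>x \<mapsto> g\<close>, where \<open>g\<close> is the element of \<open>v\<close> with \<open>r g = p x\<close>.\<close>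

definition pt :: "'g \<Rightarrow> 'g \<Rightarrow> 'x" where
  "pt v a = p (img (gr G) (inf v a))"

lemma pt_top: "pt v top = p (img (gr G) v)"
  by (simp add: pt_def)

lemma composable_pt: "R.is_section v \<Longrightarrow> composable (gr G) p (pt v) id"
  unfolding composable_def partial_point_def pt_def
  by (simp add: inf_SUP_frame inf_Sup_frame R.img_Sup partial_point_Sup[OF partial_point_p] image_image
      R.img_inf_section partial_point_inf[OF partial_point_p] R.frobenius)

lemma partial_point_pt: "R.is_section v \<Longrightarrow> partial_point (pt v)"
  using composable_pt by (auto simp: composable_def)

lemma GX_swap: "U \<in> GX G p \<Longrightarrow> (inf a (gr G c), y) \<in> U \<longleftrightarrow> (a, inf y (p c)) \<in> U"
  unfolding GX_def by (rule PB_swap)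

lemma GX_down: "U \<in> GX G p \<Longrightarrow> (a', y') \<in> U \<Longrightarrow> a \<le> a' \<Longrightarrow> y \<le> y' \<Longrightarrow> (a, y) \<in> U"
  unfolding GX_def by (rule PB.pullback_down) auto

lemma GX_Sup1: "U \<in> GX G p \<Longrightarrow> (\<And>a. a \<in> S \<Longrightarrow> (a, y) \<in> U) \<Longrightarrow> (Sup S, y) \<in> U"
  unfolding GX_def by (rule PB.pullback_Sup) auto

lemma GX_Sup2: "U \<in> GX G p \<Longrightarrow> (\<And>y. y \<in> T \<Longrightarrow> (a, y) \<in> U) \<Longrightarrow> (a, Sup T) \<in> U"
  using PB.pullback_join[of U "gr G" p T a] by (simp add: join_UNIV GX_def)

lemma GX_tensor: "tensor (GX G p) a y \<in> GX G p" "(a, y) \<in> tensor (GX G p) a y"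
  "W \<in> GX G p \<Longrightarrow> tensor (GX G p) a y \<subseteq> W \<longleftrightarrow> (a, y) \<in> W"
  by (simp_all add: GX_def PB.tensor_in PB.tensor_mem PB.tensor_le_iff)

lemma GX_carrier: "complete_carrier (GX G p)"
  unfolding GX_def by (rule PB.pullback_carrier)

lemma GX_Int: "U \<in> GX G p \<Longrightarrow> V \<in> GX G p \<Longrightarrow> U \<inter> V \<in> GX G p"
  unfolding GX_def by (rule PB.Int_in_pullback)

lemma GX_meet: "U \<in> GX G p \<Longrightarrow> V \<in> GX G p \<Longrightarrow> meet (GX G p) U V = U \<inter> V"
  unfolding GX_def by (rule PB.meet_pullback)

text \<open>The restriction of an open part of \<open>G\<^sub>1 \<otimes> X\<close> to \<open>v \<otimes> X \<cong> p\<^sup>*(r\<^sub>! v)\<close>.\<close>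

definition restr :: "'g \<Rightarrow> ('g \<times> 'x) set \<Rightarrow> 'x" where
  "restr v U = ev (pt v) id U"

lemma
  assumes "R.is_section v"
  shows restr_join: "\<S> \<subseteq> GX G p \<Longrightarrow> restr v (join (GX G p) \<S>) = (SUP U\<in>\<S>. restr v U)"
    and restr_tensor: "restr v (tensor (GX G p) a y) = inf (pt v a) y"
    and restr_Int: "U \<in> GX G p \<Longrightarrow> V \<in> GX G p \<Longrightarrow> restr v (U \<inter> V) = inf (restr v U) (restr v V)"
    and restr_UNIV: "restr v UNIV = p (img (gr G) v)"
  using PB_ev_join[OF composable_pt[OF assms]] PB_ev_tensor[OF composable_pt[OF assms]]
    PB_ev_Int[OF composable_pt[OF assms]] PB_ev_one[OF composable_pt[OF assms]]
  unfolding restr_def GX_def by (simp_all add: pt_top)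

text \<open>For \<open>(a, y)\<close> in \<open>U\<close>, the section \<open>v\<close> writes
  \<open>inf v a\<close> as \<open>inf v (gr G c)\<close>, and the swap rule carries
  \<open>c\<close> over to \<open>X\<close>. Joining these pieces puts \<open>(v, restr v U)\<close>
  in \<open>U\<close>.\<close>

lemma mem_iff_restr:
  assumes U: "U \<in> GX G p" and v: "R.is_section v"
  shows "(v, y) \<in> U \<longleftrightarrow> inf y (p (img (gr G) v)) \<le> restr v U"
proof
  assume "(v, y) \<in> U"
  then show "inf y (p (img (gr G) v)) \<le> restr v U"
    unfolding restr_def using ev_upper[of v y U "pt v" id] by (simp add: pt_def inf_commute)
next
  have "(v, inf (pt v a) y) \<in> U" if "(a, y) \<in> U" for a y
  proof -
    have "inf v (gr G (img (gr G) (inf v a))) = inf v a" using v by (rule section_ofD) simp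
    then have "(inf v (gr G (img (gr G) (inf v a))), y) \<in> U"
      using that by (auto intro: GX_down[OF U])
    then show ?thesis using GX_swap[OF U] by (simp add: pt_def inf_commute)
  qed
  then have "(v, restr v U) \<in> U" unfolding restr_def ev_def by (intro GX_Sup2[OF U]) auto
  moreover assume "inf y (p (img (gr G) v)) \<le> restr v U"
  ultimately have "(inf v (gr G (img (gr G) v)), y) \<in> U"
    using GX_down[OF U] GX_swap[OF U] by blast
  then show "(v, y) \<in> U" by (simp add: inf.absorb1 R.unit)
qed

lemma mem_iff_bisections:
  assumes "U \<in> GX G p"
  shows "(a, y) \<in> U \<longleftrightarrow> (\<forall>v. bisection v \<and> v \<le> a \<longrightarrow> (v, y) \<in> U)"
  using GX_Sup1[OF assms, of "{v. bisection v \<and> v \<le> a}" y] GX_down[OF assms]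
  by (auto simp: bisections_dense)

lemma GX_subsetI:
  assumes "U \<in> GX G p" "W \<in> GX G p" "\<And>v. bisection v \<Longrightarrow> restr v U \<le> restr v W"
  shows "U \<subseteq> W"
proof clarify
  fix a y assume "(a, y) \<in> U"
  then show "(a, y) \<in> W"
    using assms mem_iff_bisections mem_iff_restr bisectionD(2) by (meson order_trans)
qed

text \<open>\<open>tr v x\<close> is the part \<open>v\<inverse> \<cdot> x\<close> of \<open>X\<close>, i.e. the inverse image of \<open>x\<close> under \<open>y \<mapsto> v \<cdot> y\<close>.\<close>

definition tr :: "'g \<Rightarrow> 'x \<Rightarrow> 'x" where
  "tr v x = restr v (\<alpha> x)"

lemma tr_ev: "tr v x = ev (pt v) id (\<alpha> x)"
  by (simp add: tr_def restr_def)

lemma partial_point_tr: "R.is_section v \<Longrightarrow> partial_point (tr v)"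
  unfolding partial_point_def tr_def
  by (auto simp: act_Sup restr_join act_in image_subset_iff image_image act_inf restr_Int)

lemma tr_mono: "R.is_section v \<Longrightarrow> x \<le> y \<Longrightarrow> tr v x \<le> tr v y"
  by (rule partial_point_mono[OF partial_point_tr])

lemma tr_top: "R.is_section v \<Longrightarrow> tr v top = p (img (gr G) v)"
  by (simp add: tr_def act_top restr_UNIV)

lemma tr_le: "R.is_section v \<Longrightarrow> tr v x \<le> p (img (gr G) v)"
  using tr_mono[of v x top] by (simp add: tr_top)

lemma tr_p: "R.is_section v \<Longrightarrow> tr v (p c) = pt v (gd G c)"
  by (simp add: tr_def act_p proj1_def one_UNIV restr_tensor)

lemma mem_act_iff: "R.is_section v \<Longrightarrow> (v, y) \<in> \<alpha> x \<longleftrightarrow> inf y (p (img (gr G) v)) \<le> tr v x"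
  by (simp add: mem_iff_restr act_in tr_def)

text \<open>In points, w (v y) = (w v) y: associativity where the middle entry is the element of
  \<open>v\<close> at y and the first, \<open>\<lambda>b. tr v (pt w b)\<close>, is the element of
  \<open>w\<close> at v y.\<close>

lemma tr_tr:
  assumes v: "R.is_section v" and w: "bisection w"
  shows "tr v (tr w x) = ev (\<lambda>a. ev (\<lambda>b. tr v (pt w b)) (pt v) (gm G a)) id (\<alpha> x)"
proof -
  have w': "R.is_section w" using w by (rule bisectionD)
  have f: "partial_point (\<lambda>b. tr v (pt w b))"
    using partial_point_comp[OF partial_point_pt[OF w'] partial_point_tr[OF v]] by (simp add: o_def)
  have g: "partial_point (pt v)" by (rule partial_point_pt[OF v])
  have "inf (tr v (pt w (gr G c))) (pt v top) = inf (tr v (pt w top)) (pt v (gd G c))" for c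
  proof -
    have "pt w (gr G c) = inf (pt w top) (p c)"
      using composable_pt[OF w'] by (simp add: composable_def)
    then have "tr v (pt w (gr G c)) = inf (tr v (pt w top)) (pt v (gd G c))"
      by (simp add: partial_point_inf[OF partial_point_tr[OF v]] tr_p[OF v])
    moreover have "tr v (pt w top) \<le> pt v top" by (simp add: pt_top tr_le[OF v])
    ultimately show ?thesis by (simp add: inf.absorb1 inf.coboundedI1)
  qed
  then have "composable (gr G) (gd G) (\<lambda>b. tr v (pt w b)) (pt v)"
    using f g by (simp add: composable_def)
  from act_assoc[OF this composable_pt[OF v], of x]
  have "ev (\<lambda>b. tr v (pt w b)) (tr v) (\<alpha> x) = ev (\<lambda>a. ev (\<lambda>b. tr v (pt w b)) (pt v) (gm G a)) id (\<alpha> x)"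
    by (simp only: tr_ev[symmetric])
  moreover have "tr v (tr w x) = ev (\<lambda>b. tr v (pt w b)) (\<lambda>y. tr v (id y)) (\<alpha> x)"
    unfolding tr_ev[of w x] by (rule partial_point_ev[OF partial_point_tr[OF v]])
  ultimately show ?thesis by simp
qed

text \<open>Together with \<open>tr_tr_i\<close> this makes \<open>tr v\<close> and
  \<open>tr (gi G v)\<close> inverse isomorphisms between the opens over the domain of
  \<open>v\<close> and those over its range.\<close>

lemma tr_i_tr:
  assumes v: "bisection v"
  shows "tr (gi G v) (tr v x) = inf (p (img (gd G) v)) x"
proof -
  let ?w = "gi G v"
  have w: "R.is_section ?w" using v section_i by (simp add: bisection_def)
  \<comment> \<open>The element of \<open>v\<close> at v^-1 y is the inverse of the element of v^-1
    at y, so their product is a unit.\<close>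
  have "tr ?w (pt v b) = pt ?w (gi G b)" for b
  proof -
    have "inf v (gr G (img (gr G) (inf v b))) = inf v b"
      using bisectionD(2)[OF v] by (rule section_ofD) simp
    then have "inf ?w (gd G (img (gr G) (inf v b))) = inf ?w (gi G b)"
      by (metis i_inf i_r)
    moreover have "tr ?w (pt v b) = p (img (gr G) (inf ?w (gd G (img (gr G) (inf v b)))))"
      unfolding pt_def[of v] tr_p[OF w] by (simp add: pt_def)
    ultimately show ?thesis by (simp add: pt_def)
  qed
  then have "tr ?w (tr v x) = ev (\<lambda>a. pt ?w (ev (gi G) id (gm G a))) id (\<alpha> x)"
    by (simp add: tr_tr[OF w v] partial_point_ev[OF partial_point_pt[OF w]])
  also have "\<dots> = ev (\<lambda>a. inf (p (img (gd G) v)) (p (gu G a))) id (\<alpha> x)"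
    by (simp add: left_inverse pt_def R.frobenius partial_point_inf[OF partial_point_p] flip: img_d)
  also have "\<dots> = inf (p (img (gd G) v)) x"
    by (simp add: act_unit flip: inf_ev)
  finally show ?thesis .
qed

lemma tr_tr_i: "bisection v \<Longrightarrow> tr v (tr (gi G v) x) = inf (p (img (gr G) v)) x"
  using tr_i_tr[OF bisection_i, of v x] by (simp add: i_i flip: img_r)

text \<open>Translation by \<open>v\<close> is a partial isomorphism, so its direct image is the
  inverse image of the opposite translation.\<close>

lemma bisection_act_adjoint:
  assumes v: "bisection v"
  shows "(v, y) \<in> \<alpha> x \<longleftrightarrow> tr (gi G v) y \<le> x"
proof -
  have w: "R.is_section (gi G v)" using v section_i by (simp add: bisection_def)
  have v': "R.is_section v" using v by (rule bisectionD)
  have "inf y (p (img (gr G) v)) \<le> tr v x \<longleftrightarrow> tr (gi G v) y \<le> x"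
  proof
    assume "inf y (p (img (gr G) v)) \<le> tr v x"
    from tr_mono[OF w this] have "tr (gi G v) (inf y (p (img (gr G) v))) \<le> x"
      using v by (simp add: tr_i_tr)
    moreover have "tr (gi G v) (inf y (p (img (gr G) v))) = tr (gi G v) y"
    proof -
      have "tr (gi G v) (p (img (gr G) v)) = tr (gi G v) (tr v top)" by (simp add: tr_top v')
      also have "\<dots> = tr (gi G v) top" using v by (simp add: tr_i_tr tr_top w flip: img_d)
      finally show ?thesis
        using partial_point_inf[OF partial_point_tr[OF w]] by (metis inf_top_right)
    qed
    ultimately show "tr (gi G v) y \<le> x" by simp
  next
    assume "tr (gi G v) y \<le> x"
    from tr_mono[OF v' this] show "inf y (p (img (gr G) v)) \<le> tr v x"
      using v by (simp add: tr_tr_i inf_commute)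
  qed
  then show ?thesis by (simp add: mem_act_iff v')
qed

text \<open>\<open>direct_image\<close> is only a \<open>LEAST\<close>, so the adjunction needs a
  witness: the join of the translates of \<open>y\<close> along the bisections below
  \<open>a\<close>.\<close>

lemma qact_adjoint: "qact G p \<alpha> a y \<le> x \<longleftrightarrow> (a, y) \<in> \<alpha> x"
proof -
  let ?z = "SUP v\<in>{v. bisection v \<and> v \<le> a}. tr (gi G v) y"
  have iff: "?z \<le> x \<longleftrightarrow> (a, y) \<in> \<alpha> x" for x
    using mem_iff_bisections[OF act_in, of a y x] bisection_act_adjoint by (auto simp: SUP_le_iff)
  have "qact G p \<alpha> a y = ?z"
    unfolding qact_def by (rule direct_image_eqI) (simp add: iff GX_tensor act_in)
  then show ?thesis using iff by simp
qed

lemma qact_bisection: "bisection v \<Longrightarrow> qact G p \<alpha> v y = tr (gi G v) y"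
  using qact_adjoint bisection_act_adjoint by (metis antisym order_refl)

section \<open>Local sections, partial units and supports in terms of the structure maps\<close>

lemma unit_mem_iff:
  assumes "U \<in> GX G p"
  shows "(e, y) \<in> U \<longleftrightarrow> y \<le> ev (\<lambda>a. p (gu G a)) id U"
proof
  assume "(e, y) \<in> U"
  then show "y \<le> ev (\<lambda>a. p (gu G a)) id U"
    using ev_upper[of e y U "\<lambda>a. p (gu G a)" id] by (simp add: u_unit p_top)
next
  \<comment> \<open>\<open>inf e (gr G (gu G a))\<close> equals \<open>inf e a\<close>, hence lies
    below \<open>a\<close>; the swap rule then moves \<open>gu G a\<close> over to
    \<open>X\<close>.\<close>
  have "(e, inf (p (gu G a)) y) \<in> U" if "(a, y) \<in> U" for a y
  proof -
    have "(inf e (gr G (gu G a)), y) \<in> U"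
      using that by (rule GX_down[OF assms]) (simp_all add: unit_inf_r flip: unit_inf)
    then show ?thesis using GX_swap[OF assms] by (simp add: inf_commute)
  qed
  then have "(e, ev (\<lambda>a. p (gu G a)) id U) \<in> U"
    unfolding ev_def by (intro GX_Sup2[OF assms]) auto
  moreover assume "y \<le> ev (\<lambda>a. p (gu G a)) id U"
  ultimately show "(e, y) \<in> U" using GX_down[OF assms] by blast
qed

lemma qact_le_unit: "b \<le> e \<Longrightarrow> qact G p \<alpha> b y = inf y (p (gu G b))"
proof -
  assume "b \<le> e"
  then have b: "b = inf e (gr G (gu G b))" by (rule unit_le_r)
  have "(b, y) \<in> \<alpha> x \<longleftrightarrow> inf y (p (gu G b)) \<le> x" for x
    by (subst b) (simp add: GX_swap act_in unit_mem_iff act_unit)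
  then show ?thesis using qact_adjoint by (metis antisym order_refl)
qed

lemma xsupp_eq: "xsupp G p x = inf e (gd G (img p x))"
  by (simp add: xsupp_def img_u)

text \<open>Acting by an element below \<open>e\<close> cuts down along \<open>p\<close>, and
  \<open>xsupp G p x\<close> is the element that cuts to \<open>p (img p x)\<close>.\<close>

lemma local_sections_iff: "s \<in> local_sections G p \<alpha> \<longleftrightarrow> P.is_section s"
  by (simp add: local_sections_def section_of_def qact_le_unit xsupp_eq
      partial_point_inf[OF partial_point_u] u_unit u_d)

text \<open>\<open>G\<close> acting on itself from the left: \<open>S.tr\<close> and its rules
  compute products in the quantale.\<close>

interpretation S: etale_action G "gd G" "gm G"
  using etale groupoid_action_self[OF groupoid]
  by unfold_locales (auto simp: etale_groupoid_def G_sheaf_def groupoid_action_def)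

lemma qmult_qact: "qmult G a b = qact G (gd G) (gm G) a b"
  by (simp add: qmult_def qact_def G2_def GX_def)

lemma qmult_adjoint: "qmult G a b \<le> c \<longleftrightarrow> (a, b) \<in> gm G c"
  by (simp add: qmult_qact S.qact_adjoint)

text \<open>Through \<open>qmult_adjoint\<close> this is the right unit law a e = a of the
  quantale.\<close>

lemma mem_mult_unit_iff: "(a, e) \<in> gm G c \<longleftrightarrow> a \<le> c"
proof
  assume "(a, e) \<in> gm G c"
  then show "a \<le> c"
    using ev_upper[of a e "gm G c" id "\<lambda>b. gr G (gu G b)"] by (simp add: right_unit u_unit r_top)
next
  have "(inf a (gr G (gu G b)), e) \<in> gm G c" if "(a, b) \<in> gm G c" for a b
    using that S.GX_down[OF S.act_in, of a b c a "inf e (gd G (gu G b))"] unit_inf[of b]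
    by (simp add: S.GX_swap S.act_in) (metis inf.cobounded2)
  then have "(ev id (\<lambda>b. gr G (gu G b)) (gm G c), e) \<in> gm G c"
    unfolding ev_def by (intro S.GX_Sup1[OF S.act_in]) auto
  moreover assume "a \<le> c"
  ultimately show "(a, e) \<in> gm G c"
    using S.GX_down[OF S.act_in] by (auto simp: right_unit)
qed

lemma tr_unit:
  assumes "bisection v"
  shows "S.tr v e = gi G v"
  using S.bisection_act_adjoint[OF bisection_i[OF assms]] mem_mult_unit_iff
  by (metis antisym order_refl i_i)

lemma partial_units_iff: "v \<in> partial_units G \<longleftrightarrow> bisection v"
proof
  assume v: "bisection v"
  have "(w, gi G w) \<in> gm G e" if "bisection w" for w
    using that by (simp add: S.mem_act_iff bisectionD tr_unit)
  from this[OF v] this[OF bisection_i[OF v]] show "v \<in> partial_units G"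
    by (simp add: partial_units_def qstar_def img_i qmult_adjoint i_i)
next
  \<comment> \<open>In points: if g and h in \<open>v\<close> have the same range, then g h^-1 is a
    unit, so g = h. The argument runs over bisections below \<open>v\<close> and below
    \<open>a\<close>.\<close>
  have key: "R.is_section v" if v: "(v, gi G v) \<in> gm G e" for v
    unfolding section_of_def
  proof (intro allI impI antisym)
    fix a assume a: "a \<le> v"
    have "inf w1 (gr G (img (gr G) w2)) \<le> a"
      if w: "bisection w1" "w1 \<le> v" "bisection w2" "w2 \<le> a" for w1 w2
    proof -
      have "(w2, gi G w1) \<in> gm G e"
        using v w a by (auto intro: S.GX_down[OF S.act_in] partial_point_mono[OF partial_point_i])
      then have "inf (gi G w1) (gd G (img (gr G) w2)) \<le> gi G w2"
        using w by (simp add: S.mem_act_iff bisectionD tr_unit)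
      then have "inf w1 (gr G (img (gr G) w2)) \<le> w2"
        by (metis i_le_iff i_i i_inf i_d)
      then show ?thesis using w by simp
    qed
    then have "inf (SUP w1\<in>{w. bisection w \<and> w \<le> v}. w1)
        (gr G (img (gr G) (SUP w2\<in>{w. bisection w \<and> w \<le> a}. w2))) \<le> a"
      unfolding SUP_inf_frame R.img_Sup partial_point_Sup[OF partial_point_r] image_image inf_SUP_frame
      by (intro SUP_least) auto
    then show "inf v (gr G (img (gr G) a)) \<le> a" by (simp add: bisections_dense)
    show "a \<le> inf v (gr G (img (gr G) a))" using a R.unit by simp
  qed
  assume "v \<in> partial_units G"
  then have "(v, gi G v) \<in> gm G e" "(gi G v, gi G (gi G v)) \<in> gm G e"
    by (auto simp: partial_units_def qstar_def img_i qmult_adjoint i_i)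
  from this[THEN key] show "bisection v" by (simp add: bisection_def section_i)
qed

lemma qsupp_bisection: "bisection v \<Longrightarrow> qsupp G v = inf e (gd G (img (gd G) v))"
  using S.tr_i_tr[of v e]
  by (simp add: qsupp_def qstar_def img_i qmult_qact S.qact_bisection tr_unit inf_commute)

lemma unit_inf_d_le_iff: "inf e (gd G a) \<le> inf e (gd G b) \<longleftrightarrow> a \<le> b"
  using unit_adjoint[of a "inf e (gd G b)"]
  by (simp add: img_u partial_point_inf[OF partial_point_u] u_unit u_d)

lemma qsupp_le_xsupp_iff:
  "bisection v \<Longrightarrow> qsupp G v \<le> xsupp G p s \<longleftrightarrow> img (gd G) v \<le> img p s"
  "bisection v \<Longrightarrow> qsupp G (qstar G v) \<le> xsupp G p s \<longleftrightarrow> img (gr G) v \<le> img p s"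
  by (simp_all add: qsupp_bisection xsupp_eq unit_inf_d_le_iff qstar_def img_i bisection_i
      del: inf.bounded_iff flip: img_r)


section \<open>The inner product\<close>

text \<open>In point notation, \<open>ip x y = {g. \<exists>z. z \<in> y \<and> g \<cdot> z \<in> x}\<close>.\<close>

definition ip :: "'x \<Rightarrow> 'x \<Rightarrow> 'g" where
  "ip x y = (SUP (a, b)\<in>\<alpha> x. inf a (gr G (img p (inf b y))))"

lemma ip_upper: "(a, b) \<in> \<alpha> x \<Longrightarrow> inf a (gr G (img p (inf b y))) \<le> ip x y"
  unfolding ip_def by (rule SUP_upper2[of "(a, b)"]) auto

lemma ip_least: "(\<And>a b. (a, b) \<in> \<alpha> x \<Longrightarrow> inf a (gr G (img p (inf b y))) \<le> c) \<Longrightarrow> ip x y \<le> c"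
  unfolding ip_def by (rule SUP_least) auto

text \<open>A member of the pullback that can bound the closure \<open>\<alpha> (Sup S)\<close> in
  \<open>ip_Sup1\<close>. The swap condition is Frobenius for \<open>p\<close>.\<close>

lemma ip_ideal: "{(a, b). inf a (gr G (img p (inf b y))) \<le> c} \<in> GX G p"
  unfolding GX_def
proof (rule PB.pullbackI)
  show "(a, b) \<in> {(a, b). inf a (gr G (img p (inf b y))) \<le> c}"
    if "(a', b') \<in> {(a, b). inf a (gr G (img p (inf b y))) \<le> c}" "a \<le> a'" "b \<le> b'" for a b a' b'
  proof -
    have "inf a (gr G (img p (inf b y))) \<le> inf a' (gr G (img p (inf b' y)))"
      using that by (intro inf_mono R.mono P.img_mono) auto
    also have "\<dots> \<le> c" using that(1) by simp
    finally show ?thesis by simp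
  qed
  show "(Sup S, b) \<in> {(a, b). inf a (gr G (img p (inf b y))) \<le> c}"
    if "\<And>a. a \<in> S \<Longrightarrow> (a, b) \<in> {(a, b). inf a (gr G (img p (inf b y))) \<le> c}" for S b
    using that SUP_inf_frame[of "\<lambda>a. a" S] by (auto intro!: SUP_least)
  show "(a, join UNIV T) \<in> {(a, b). inf a (gr G (img p (inf b y))) \<le> c}"
    if "\<And>b. b \<in> T \<Longrightarrow> (a, b) \<in> {(a, b). inf a (gr G (img p (inf b y))) \<le> c}" for a T
    using that SUP_inf_frame[of "\<lambda>b. b" T y]
    by (auto simp: join_UNIV inf_SUP_frame P.img_Sup image_image
        partial_point_Sup[OF partial_point_r] intro!: SUP_least)
  show "(inf a (gr G o'), b) \<in> {(a, b). inf a (gr G (img p (inf b y))) \<le> c} \<longleftrightarrow>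
      (a, meet UNIV b (p o')) \<in> {(a, b). inf a (gr G (img p (inf b y))) \<le> c}" for a b o'
  proof -
    have eq: "inf (inf b (p o')) y = inf (inf b y) (p o')" by (simp add: ac_simps)
    have "inf (inf a (gr G o')) (gr G (img p (inf b y))) = inf a (gr G (img p (inf (inf b (p o')) y)))"
      unfolding eq P.frobenius partial_point_inf[OF partial_point_r] by (simp add: ac_simps)
    then show ?thesis by (simp add: meet_UNIV)
  qed
qed auto

lemma ip_Sup1: "ip (Sup S) y = (SUP x\<in>S. ip x y)"
proof (rule antisym)
  let ?I = "{(a, b). inf a (gr G (img p (inf b y))) \<le> (SUP x\<in>S. ip x y)}"
  have "\<alpha> x \<subseteq> ?I" if "x \<in> S" for x
    using ip_upper that by (auto intro!: SUP_upper2[of x])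
  then have "\<alpha> (Sup S) \<subseteq> ?I"
    unfolding act_Sup by (subst join_le_iff[OF GX_carrier _ ip_ideal]) (auto simp: act_in)
  then show "ip (Sup S) y \<le> (SUP x\<in>S. ip x y)" by (auto intro: ip_least)
  have "\<alpha> x \<subseteq> \<alpha> (Sup S)" if "x \<in> S" for x
    using act_inf[of x "Sup S"] that by (auto simp: inf.absorb1 Sup_upper)
  then show "(SUP x\<in>S. ip x y) \<le> ip (Sup S) y"
    by (auto intro!: SUP_least ip_least ip_upper)
qed

lemma ip_Sup2: "ip x (Sup T) = (SUP y\<in>T. ip x y)"
  unfolding ip_def
  by (subst SUP_commute)
     (simp add: inf_Sup_frame P.img_Sup image_image partial_point_Sup[OF partial_point_r] case_prod_unfold)

lemma ip_sections:
  assumes s: "P.is_section s" and t: "P.is_section t"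
  shows "ip s t = Sup {v \<in> partial_units G. qsupp G v \<le> xsupp G p s \<and>
           qsupp G (qstar G v) \<le> xsupp G p t \<and> qact G p \<alpha> v t \<le> s}" (is "_ = Sup ?V")
proof (rule antisym)
  show "Sup ?V \<le> ip s t"
  proof (rule Sup_least)
    fix v assume v: "v \<in> ?V"
    then have b: "bisection v" by (simp add: partial_units_iff)
    with v have "(v, t) \<in> \<alpha> s" and r: "img (gr G) v \<le> img p t"
      by (simp_all add: qact_adjoint qsupp_le_xsupp_iff)
    then have "inf v (gr G (img p t)) \<le> ip s t" using ip_upper[of v t s t] by simp
    moreover have "v \<le> gr G (img p t)" using r by (simp add: R.adjoint)
    ultimately show "v \<le> ip s t" by (simp add: inf.absorb1)
  qed
  show "ip s t \<le> Sup ?V"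
  proof (rule ip_least)
    fix a b assume ab: "(a, b) \<in> \<alpha> s"
    have "inf w (gr G (img p (inf b t))) \<le> Sup ?V" if w: "bisection w" "w \<le> a" for w
    proof -
      note w' = bisectionD(2)[OF w(1)]
      \<comment> \<open>\<open>y\<close> is the part of \<open>inf b t\<close> over the range of
        \<open>w\<close>, and \<open>v\<close> the part of \<open>w\<close> based there; then the
        range of \<open>v\<close> is exactly \<open>img p y\<close>, and v t lies in
        \<open>s\<close>.\<close>
      define y where "y = inf (inf b t) (p (img (gr G) w))"
      define v where "v = inf w (gr G (img p y))"
      have img_y: "img p y = inf (img p (inf b t)) (img (gr G) w)"
        by (simp add: y_def P.frobenius)
      have v_eq: "v = inf w (gr G (img p (inf b t)))"
        unfolding v_def img_y partial_point_inf[OF partial_point_r]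
        by (metis R.unit inf.absorb1 inf_commute inf_left_commute)
      have v: "bisection v" using bisection_down[OF w(1)] by (simp add: v_def)
      note v' = bisectionD(2)[OF v]
      have y: "y \<le> t" "y \<le> b" by (simp_all add: y_def inf.coboundedI1)
      have r_v: "img (gr G) v = img p y"
        by (simp add: v_def R.frobenius img_y inf.absorb2 inf.absorb1 inf_commute)
      have "(w, y) \<in> \<alpha> s" using ab w y by (auto intro: GX_down[OF act_in])
      moreover have "inf t (p (img p y)) = y" using t y(1) by (rule section_ofD)
      ultimately have vt: "(v, t) \<in> \<alpha> s" by (simp add: v_def GX_swap act_in)
      \<comment> \<open>The part \<open>y\<close> is carried by \<open>v\<close> into
        \<open>s\<close>, which bounds the domain of \<open>v\<close> by \<open>img p s\<close>; the
        section property for \<open>gr G\<close> turns the inclusion of ranges into one below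
        \<open>v\<close>.\<close>
      then have "y \<le> tr v s"
        using y P.unit[of y] by (simp add: mem_act_iff v' r_v) (meson le_inf_iff order_trans)
      also have "\<dots> \<le> tr v (p (img p s))" using v' P.unit by (rule tr_mono)
      also have "\<dots> = p (img (gr G) (inf v (gd G (img p s))))" by (simp add: tr_p v' pt_def)
      finally have "img (gr G) v \<le> img (gr G) (inf v (gd G (img p s)))"
        by (simp add: r_v P.adjoint)
      then have "inf v (gr G (img (gr G) v)) \<le> inf v (gr G (img (gr G) (inf v (gd G (img p s)))))"
        using R.mono by (intro inf_mono) auto
      also have "\<dots> = inf v (gd G (img p s))" using v' by (rule section_ofD) simp
      finally have "v \<le> gd G (img p s)" by (simp add: inf.absorb1 R.unit)
      then have "img (gd G) v \<le> img p s" by (simp only: D.adjoint)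
      moreover have "img (gr G) v \<le> img p t" unfolding r_v using y(1) by (rule P.img_mono)
      ultimately have "v \<in> ?V" using v vt by (simp add: partial_units_iff qsupp_le_xsupp_iff qact_adjoint)
      then have "v \<le> Sup ?V" by (rule Sup_upper)
      then show ?thesis by (simp only: v_eq)
    qed
    then have "inf (gr G (img p (inf b t))) (SUP w\<in>{w. bisection w \<and> w \<le> a}. w) \<le> Sup ?V"
      unfolding inf_SUP_frame by (intro SUP_least) (auto simp: inf_commute)
    then show "inf a (gr G (img p (inf b t))) \<le> Sup ?V"
      by (simp add: bisections_dense inf_commute)
  qed
qed

text \<open>Local sections are dense, so preservation of joins determines an inner product by its
  values on them; \<open>ip\<close> gives existence.\<close>

lemma inner_product_eq: "inner_product G p \<alpha> = ip"
  unfolding inner_product_def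
proof (rule the_equality)
  show ip: "is_inner_product G p \<alpha> ip"
    by (simp add: is_inner_product_def ip_Sup1 ip_Sup2 ip_sections local_sections_iff)
  fix \<phi> assume \<phi>: "is_inner_product G p \<alpha> \<phi>"
  have "\<phi> x y = ip x y" for x y
  proof -
    let ?D = "\<lambda>x. {s. P.is_section s \<and> s \<le> x}"
    have "\<psi> x y = (SUP s\<in>?D x. SUP t\<in>?D y. \<psi> s t)" if "is_inner_product G p \<alpha> \<psi>" for \<psi>
    proof -
      have "\<psi> x y = \<psi> (Sup (?D x)) (Sup (?D y))" by (simp add: P.sections_dense)
      also have "\<dots> = (SUP s\<in>?D x. \<psi> s (Sup (?D y)))"
        using that unfolding is_inner_product_def by blast
      also have "\<dots> = (SUP s\<in>?D x. SUP t\<in>?D y. \<psi> s t)"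
        using that unfolding is_inner_product_def by simp
      finally show ?thesis .
    qed
    from this[OF \<phi>] this[OF ip] show ?thesis
      using \<phi> by (auto simp: is_inner_product_def local_sections_iff ip_sections intro!: SUP_cong)
  qed
  then show "\<phi> = ip" by blast
qed

lemma pr1_in: "GX_\<pi>1 G p a \<in> GX G p" and pr2_in: "GX_\<pi>2 G p y \<in> GX G p"
  and pr2_mem: "(a, y) \<in> GX_\<pi>2 G p y"
  and restr_pr1: "R.is_section v \<Longrightarrow> restr v (GX_\<pi>1 G p a) = pt v a"
  and restr_pr2: "R.is_section v \<Longrightarrow> restr v (GX_\<pi>2 G p y) = inf (p (img (gr G) v)) y"
  unfolding proj1_def proj2_def one_UNIV
  by (simp_all add: GX_tensor restr_tensor pt_top)
     (rule GX_down[OF GX_tensor(1,2)], simp_all)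

lemma restr_act_pr2:
  assumes "R.is_section v"
  shows "restr v (\<alpha> a \<inter> GX_\<pi>2 G p b) = inf (tr v a) b"
  using tr_le[OF assms, of a]
  by (simp add: restr_Int assms act_in pr2_in restr_pr2 inf.absorb1 flip: tr_def inf_assoc)

text \<open>In point notation: \<open>g \<cdot> z \<in> s\<close> and \<open>z \<in> s\<close> force \<open>g\<close> to be a unit.\<close>

definition unit_bounded :: "'x \<Rightarrow> bool" where
  "unit_bounded s \<longleftrightarrow> \<alpha> s \<inter> GX_\<pi>2 G p s \<subseteq> GX_\<pi>1 G p e"

text \<open>\<open>ip s s\<close> is the direct image of
  \<open>\<alpha> s \<inter> GX_\<pi>2 G p s\<close> under the first projection, so both sides say
  that this open lies over the units.\<close>

lemma ip_self_le_unit_iff: "ip s s \<le> e \<longleftrightarrow> unit_bounded s"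
proof
  assume ip: "ip s s \<le> e"
  show "unit_bounded s"
    unfolding unit_bounded_def
  proof (rule GX_subsetI)
    fix v assume "bisection v"
    then have v: "R.is_section v" by (rule bisectionD)
    let ?y = "inf (tr v s) s"
    have "(v, ?y) \<in> \<alpha> s" by (simp add: mem_act_iff v inf.coboundedI1)
    then have "inf v (gr G (img p ?y)) \<le> e"
      using ip_upper[of v ?y s s] ip by (simp add: inf_assoc)
    then have "img (gr G) (inf v (gr G (img p ?y))) \<le> img (gr G) (inf v e)"
      by (intro R.img_mono) simp
    then have "p (inf (img (gr G) v) (img p ?y)) \<le> pt v e"
      unfolding pt_def by (intro P.mono) (simp add: R.frobenius)
    moreover have "?y \<le> p (inf (img (gr G) v) (img p ?y))"
      using tr_le[OF v, of s] P.unit[of ?y]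
      by (simp add: partial_point_inf[OF partial_point_p] inf.coboundedI1)
    ultimately show "restr v (\<alpha> s \<inter> GX_\<pi>2 G p s) \<le> restr v (GX_\<pi>1 G p e)"
      by (simp add: v restr_act_pr2 restr_pr1)
  qed (simp_all add: GX_Int act_in pr1_in pr2_in)
next
  assume s: "unit_bounded s"
  show "ip s s \<le> e"
  proof (rule ip_least)
    fix a b assume "(a, b) \<in> \<alpha> s"
    then have "(a, inf b s) \<in> \<alpha> s \<inter> GX_\<pi>2 G p s"
      by (auto intro: GX_down[OF act_in] GX_down[OF pr2_in pr2_mem])
    moreover have "GX_\<pi>1 G p e \<subseteq> {(a, b). inf a (gr G (img p (inf b top))) \<le> e}"
      unfolding proj1_def one_UNIV by (subst GX_tensor(3)[OF ip_ideal]) simp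
    ultimately show "inf a (gr G (img p (inf b s))) \<le> e"
      using s by (auto simp: unit_bounded_def)
  qed
qed

lemma unit_bounded_down: "unit_bounded s \<Longrightarrow> t \<le> s \<Longrightarrow> unit_bounded t"
proof -
  assume s: "unit_bounded s" and t: "t \<le> s"
  have "\<alpha> t \<subseteq> \<alpha> s" using act_inf[of t s] t by (auto simp: inf.absorb1)
  moreover have "GX_\<pi>2 G p t \<subseteq> GX_\<pi>2 G p s"
    using t unfolding proj2_def one_UNIV by (auto simp: GX_tensor intro: GX_down[OF GX_tensor(1,2)])
  ultimately show "unit_bounded t" using s by (auto simp: unit_bounded_def)
qed

lemma principal_sections_iff: "s \<in> principal_sections G p \<alpha> \<longleftrightarrow> P.is_section s \<and> unit_bounded s"
  by (simp add: principal_sections_def local_sections_iff inner_product_eq ip_self_le_unit_iff)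


section \<open>Orbits\<close>

text \<open>The composite is translation by the product w v, whose element at a point is the
  generalized element \<open>\<lambda>a. pt v (S.tr w a)\<close>.\<close>

lemma tr_mult:
  assumes v: "R.is_section v" and w: "bisection w"
  shows "tr v (tr w x) = ev (\<lambda>a. pt v (S.tr w a)) id (\<alpha> x)"
proof -
  have "ev (\<lambda>b. tr v (pt w b)) (pt v) (gm G a) = pt v (S.tr w a)" for a
    by (simp add: S.tr_ev partial_point_ev[OF partial_point_pt[OF v]] pt_def[of w] tr_p[OF v] S.pt_def)
  then show ?thesis by (simp add: tr_tr[OF v w])
qed

lemma composable_tr_mult:
  assumes v: "R.is_section v" and w: "R.is_section w"
  shows "composable (gr G) p (\<lambda>a. pt v (S.tr w a)) id"
proof -
  have "partial_point (\<lambda>a. pt v (S.tr w a))"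
    using partial_point_comp[OF S.partial_point_tr[OF w] partial_point_pt[OF v]] by (simp add: o_def)
  moreover have "S.tr w (gr G c) = inf (S.tr w top) (gr G c)" for c
    by (simp add: S.tr_def m_r proj2_def one_UNIV G2_def S.act_top S.restr_UNIV w
        S.restr_tensor[unfolded GX_def] S.pt_top)
  moreover have "pt v (inf a (gr G c)) = inf (pt v a) (p c)" for a c
    using R.frobenius[of "inf v a" c] by (simp add: pt_def inf_assoc partial_point_inf[OF partial_point_p])
  ultimately show ?thesis by (simp add: composable_def partial_point_id)
qed

text \<open>The product w v is covered by bisections \<open>c\<close>, and where it meets
  \<open>c\<close> the composite translates as \<open>c\<close> does. This is transitivity of the
  orbit relation.\<close>

lemma tr_tr_le:
  assumes v: "R.is_section v" and w: "bisection w"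
  shows "tr v (tr w x) \<le> (SUP c\<in>{c. bisection c}. tr c x)"
proof -
  note w' = bisectionD(2)[OF w]
  have pp: "partial_point (\<lambda>a. pt v (S.tr w a))"
    using composable_tr_mult[OF v w'] by (simp add: composable_def)
  have le: "inf (pt v (S.tr w c)) y \<le> tr c x" if c: "bisection c" and y: "(c, y) \<in> \<alpha> x" for c y
  proof -
    have "pt v (S.tr w c) \<le> pt v (S.tr w (gr G (img (gr G) c)))"
      by (rule partial_point_mono[OF pp]) (rule R.unit)
    also have "\<dots> \<le> p (img (gr G) c)"
      using composable_tr_mult[OF v w'] by (simp add: composable_def)
    finally have "inf (pt v (S.tr w c)) y \<le> inf y (p (img (gr G) c))" by (simp add: le_infI1)
    also have "\<dots> \<le> tr c x" using y by (simp add: mem_act_iff bisectionD[OF c])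
    finally show ?thesis .
  qed
  show ?thesis
    unfolding tr_mult[OF v w]
  proof (rule ev_least)
    fix a y assume ay: "(a, y) \<in> \<alpha> x"
    have "inf (pt v (S.tr w a)) (id y) = (SUP c\<in>{c. bisection c \<and> c \<le> a}. inf (pt v (S.tr w c)) y)"
      using partial_point_Sup[OF pp, of "{c. bisection c \<and> c \<le> a}"]
      by (simp add: bisections_dense SUP_inf_frame)
    also have "\<dots> \<le> (SUP c\<in>{c. bisection c}. tr c x)"
      using ay le by (intro SUP_mono) (auto intro!: GX_down[OF act_in ay])
    finally show "inf (pt v (S.tr w a)) (id y) \<le> (SUP c\<in>{c. bisection c}. tr c x)" .
  qed
qed

abbreviation orbits :: "'x set" where "orbits \<equiv> orbit_locale G p \<alpha>"

abbreviation \<tau> :: "'x \<Rightarrow> 'x" where "\<tau> \<equiv> direct_image orbits id"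

lemma orbit_iff: "x \<in> orbits \<longleftrightarrow> (\<forall>v. bisection v \<longrightarrow> tr v x = inf (p (img (gr G) v)) x)"
proof
  assume "x \<in> orbits"
  then have "\<alpha> x = GX_\<pi>2 G p x" by (simp add: orbit_locale_def)
  then show "\<forall>v. bisection v \<longrightarrow> tr v x = inf (p (img (gr G) v)) x"
    by (simp add: tr_def restr_pr2 bisectionD)
next
  assume "\<forall>v. bisection v \<longrightarrow> tr v x = inf (p (img (gr G) v)) x"
  then have "restr v (\<alpha> x) = restr v (GX_\<pi>2 G p x)" if "bisection v" for v
    using that by (simp add: restr_pr2 bisectionD flip: tr_def)
  then have "\<alpha> x = GX_\<pi>2 G p x"
    by (intro subset_antisym GX_subsetI act_in pr2_in) auto
  then show "x \<in> orbits" by (simp add: orbit_locale_def)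
qed

lemma unit_act: "(e, x) \<in> \<alpha> x"
  by (simp add: unit_mem_iff act_in act_unit)

lemma le_tr_unit: "x \<le> tr e x"
proof -
  have "top \<le> gu G (gr G (img (gr G) e))"
    using partial_point_mono[OF partial_point_u R.unit] u_unit by metis
  then have "img (gr G) e = top" by (simp add: u_r top_unique)
  then show ?thesis
    using unit_act[of x] by (simp add: mem_act_iff bisectionD bisection_unit p_top)
qed

text \<open>The join of all translates is the saturation of \<open>x\<close>: it is invariant by
  \<open>tr_tr_le\<close> and inverse bisections, lies above \<open>x\<close> because of
  \<open>e\<close>, and lies below every invariant open above \<open>x\<close>.\<close>

lemma
  shows \<tau>_eq: "\<tau> x = (SUP c\<in>{c. bisection c}. tr c x)"
    and \<tau>_in: "\<tau> x \<in> orbits"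
    and \<tau>_adjoint: "y \<in> orbits \<Longrightarrow> \<tau> x \<le> y \<longleftrightarrow> x \<le> y"
proof -
  let ?z = "SUP c\<in>{c. bisection c}. tr c x"
  have x: "x \<le> ?z" using le_tr_unit bisection_unit by (intro SUP_upper2[of e]) auto
  have le: "tr v ?z \<le> ?z" if "bisection v" for v
    using that tr_tr_le
    by (auto simp: partial_point_Sup[OF partial_point_tr] bisectionD image_image intro!: SUP_least)
  have z: "?z \<in> orbits"
    unfolding orbit_iff
  proof (intro allI impI antisym)
    fix v assume v: "bisection v"
    show "tr v ?z \<le> inf (p (img (gr G) v)) ?z" using v le tr_le bisectionD by auto
    have "inf (p (img (gr G) v)) ?z = tr v (tr (gi G v) ?z)" using v by (simp add: tr_tr_i)
    also have "\<dots> \<le> tr v ?z" using v by (intro tr_mono le bisection_i bisectionD)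
    finally show "inf (p (img (gr G) v)) ?z \<le> tr v ?z" .
  qed
  have least: "?z \<le> y" if "y \<in> orbits" "x \<le> y" for y
  proof (rule SUP_least)
    fix c assume "c \<in> {c. bisection c}"
    then have c: "bisection c" by simp
    have "tr c x \<le> tr c y" using bisectionD(2)[OF c] that(2) by (rule tr_mono)
    moreover have "tr c y \<le> y" using that(1) c by (simp add: orbit_iff)
    ultimately show "tr c x \<le> y" by (rule order_trans)
  qed
  show \<tau>: "\<tau> x = ?z"
    unfolding direct_image_def by (rule Least_equality) (use x z least in auto)
  show "\<tau> x \<in> orbits" by (simp add: \<tau> z)
  show "y \<in> orbits \<Longrightarrow> \<tau> x \<le> y \<longleftrightarrow> x \<le> y" using least x by (auto simp: \<tau>)
qed

lemma \<tau>_unit: "x \<le> \<tau> x"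
  using \<tau>_adjoint[OF \<tau>_in] by blast

lemma \<tau>_Sup: "\<tau> (Sup S) = (SUP x\<in>S. \<tau> x)"
  unfolding \<tau>_eq
  by (subst SUP_commute) (auto simp: partial_point_Sup[OF partial_point_tr] bisectionD intro!: SUP_cong)

lemma \<tau>_frobenius: "y \<in> orbits \<Longrightarrow> \<tau> (inf x y) = inf (\<tau> x) y"
proof -
  assume y: "y \<in> orbits"
  have "tr c (inf x y) = inf (tr c x) y" if c: "bisection c" for c
  proof -
    have "tr c y = inf (p (img (gr G) c)) y" using y c by (simp add: orbit_iff)
    then have "tr c (inf x y) = inf (inf (tr c x) (p (img (gr G) c))) y"
      using c by (simp add: partial_point_inf[OF partial_point_tr] bisectionD inf_assoc)
    then show ?thesis using tr_le[of c x] c by (simp add: inf.absorb1 bisectionD)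
  qed
  then show ?thesis by (auto simp: \<tau>_eq SUP_inf_frame intro!: SUP_cong)
qed

lemma \<tau>_mono: "x \<le> y \<Longrightarrow> \<tau> x \<le> \<tau> y"
  using \<tau>_adjoint[OF \<tau>_in] \<tau>_unit order_trans by blast

lemma tr_le_\<tau>: "bisection v \<Longrightarrow> tr v x \<le> \<tau> x"
  unfolding \<tau>_eq by (rule SUP_upper) simp

lemma \<tau>_tr:
  assumes v: "bisection v" and x: "x \<le> p (img (gr G) v)"
  shows "\<tau> (tr (gi G v) x) = \<tau> x"
proof (rule antisym)
  show "\<tau> (tr (gi G v) x) \<le> \<tau> x"
    using tr_le_\<tau>[OF bisection_i[OF v]] by (simp add: \<tau>_adjoint \<tau>_in)
  have "x = tr v (tr (gi G v) x)" using x by (simp add: tr_tr_i[OF v] inf.absorb2)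
  also have "\<dots> \<le> \<tau> (tr (gi G v) x)" by (rule tr_le_\<tau>[OF v])
  finally show "\<tau> x \<le> \<tau> (tr (gi G v) x)" by (simp add: \<tau>_adjoint \<tau>_in)
qed


section \<open>The comparison map\<close>

abbreviation XX :: "('x \<times> 'x) set set" where
  "XX \<equiv> pullback UNIV UNIV orbits id id"

abbreviation \<Phi> :: "('x \<times> 'x) set \<Rightarrow> ('g \<times> 'x) set" where
  "\<Phi> \<equiv> pairing (GX G p) \<alpha> (GX_\<pi>2 G p)"

interpretation XX: pullback_frame "UNIV :: 'x set" orbits "id :: 'x \<Rightarrow> 'x" id
  by (rule pullback_frame_UNIV)

lemma XX_swap: "U \<in> XX \<Longrightarrow> y \<in> orbits \<Longrightarrow> (inf a y, b) \<in> U \<longleftrightarrow> (a, inf b y) \<in> U"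
  using XX.pullback_swap[of U b y a] by (simp add: meet_UNIV)

lemma XX_down: "U \<in> XX \<Longrightarrow> (a', b') \<in> U \<Longrightarrow> a \<le> a' \<Longrightarrow> b \<le> b' \<Longrightarrow> (a, b) \<in> U"
  by (rule XX.pullback_down) auto

lemma XX_Sup1: "U \<in> XX \<Longrightarrow> (\<And>a. a \<in> S \<Longrightarrow> (a, b) \<in> U) \<Longrightarrow> (Sup S, b) \<in> U"
  by (rule XX.pullback_Sup) auto

lemma XX_Sup2: "U \<in> XX \<Longrightarrow> (\<And>b. b \<in> T \<Longrightarrow> (a, b) \<in> U) \<Longrightarrow> (a, Sup T) \<in> U"
  using XX.pullback_join[of U T a] by (simp add: join_UNIV)

text \<open>The pair (v z, z) is a generalized point of the kernel pair of the orbit map, since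
  \<open>tr v\<close> only cuts an invariant open down to the domain of the translation.\<close>

lemma XX_tr:
  assumes v: "bisection v"
  shows "{(a, b). inf (tr v a) b \<le> z} \<in> XX" and "ev (tr v) id (tensor XX a b) = inf (tr v a) b"
proof -
  note v' = bisectionD(2)[OF v]
  have *: "inf (tr v (id c)) (id (one UNIV)) = inf (tr v top) (id (id c))" if "c \<in> orbits" for c
    using that v by (simp add: one_UNIV orbit_iff tr_top v')
  show "{(a, b). inf (tr v a) b \<le> z} \<in> XX"
    using XX.ev_ideal_in_pullback[of "tr v" id z] * by (simp add: partial_point_tr v' join_UNIV meet_UNIV)
  show "ev (tr v) id (tensor XX a b) = inf (tr v a) b"
    using XX.ev_tensor[of "tr v" id b a] * by (simp add: partial_point_tr v' join_UNIV meet_UNIV)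
qed

lemma \<Phi>_in: "\<Phi> U \<in> GX G p"
  using PB.pairing_in[of U \<alpha> "gr G" p "GX_\<pi>2 G p"] act_in pr2_in by (simp add: GX_def)

lemma \<Phi>_upper: "(a, b) \<in> U \<Longrightarrow> \<alpha> a \<inter> GX_\<pi>2 G p b \<subseteq> \<Phi> U"
  and \<Phi>_least: "W \<in> GX G p \<Longrightarrow> (\<And>a b. (a, b) \<in> U \<Longrightarrow> \<alpha> a \<inter> GX_\<pi>2 G p b \<subseteq> W) \<Longrightarrow> \<Phi> U \<subseteq> W"
proof -
  have sub: "(\<lambda>(a, b). meet (GX G p) (\<alpha> a) (GX_\<pi>2 G p b)) ` U \<subseteq> GX G p"
    by (auto simp: GX_meet act_in pr2_in GX_Int)
  show "\<alpha> a \<inter> GX_\<pi>2 G p b \<subseteq> \<Phi> U" if "(a, b) \<in> U"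
    unfolding pairing_def
    using join_upper[OF GX_carrier sub, of "\<alpha> a \<inter> GX_\<pi>2 G p b"] that
    by (force simp: GX_meet act_in pr2_in)
  show "\<Phi> U \<subseteq> W" if "W \<in> GX G p" "\<And>a b. (a, b) \<in> U \<Longrightarrow> \<alpha> a \<inter> GX_\<pi>2 G p b \<subseteq> W"
    unfolding pairing_def
    using join_le_iff[OF GX_carrier sub that(1)] that(2) by (auto simp: GX_meet act_in pr2_in)
qed

lemma \<Phi>_mono: "U \<subseteq> V \<Longrightarrow> \<Phi> U \<subseteq> \<Phi> V"
  by (rule \<Phi>_least[OF \<Phi>_in]) (auto dest: \<Phi>_upper)

lemma restr_\<Phi>:
  assumes v: "R.is_section v"
  shows "restr v (\<Phi> U) = ev (tr v) id U"
proof -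
  have "restr v (\<Phi> U) = ev (\<lambda>a. restr v (\<alpha> a)) (\<lambda>b. restr v (GX_\<pi>2 G p b)) U"
    unfolding restr_def
    using PB_ev_pairing[OF composable_pt[OF v], of \<alpha> "GX_\<pi>2 G p" U] act_in pr2_in
    by (simp flip: GX_def)
  also have "\<dots> = ev (tr v) id U"
    by (rule ev_cong) (simp add: restr_pr2 v tr_le inf.absorb1 flip: tr_def inf_assoc)
  finally show ?thesis .
qed

text \<open>The right adjoint of \<open>\<Phi>\<close> at \<open>W\<close>, used as the preimage of
  \<open>W\<close>. Inclusion is tested along bisections, which makes the set an intersection of
  ideals from \<open>XX_tr\<close>.\<close>

lemma preimage_in_XX:
  assumes W: "W \<in> GX G p"
  shows "{(a, b). \<alpha> a \<inter> GX_\<pi>2 G p b \<subseteq> W} \<in> XX"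
proof -
  have "\<alpha> a \<inter> GX_\<pi>2 G p b \<subseteq> W \<longleftrightarrow> (\<forall>v. bisection v \<longrightarrow> inf (tr v a) b \<le> restr v W)" for a b
  proof
    assume "\<alpha> a \<inter> GX_\<pi>2 G p b \<subseteq> W"
    then have "restr v (\<alpha> a \<inter> GX_\<pi>2 G p b) \<le> restr v W" for v unfolding restr_def by (rule ev_mono)
    then show "\<forall>v. bisection v \<longrightarrow> inf (tr v a) b \<le> restr v W"
      by (metis restr_act_pr2 bisectionD(2))
  next
    assume "\<forall>v. bisection v \<longrightarrow> inf (tr v a) b \<le> restr v W"
    then show "\<alpha> a \<inter> GX_\<pi>2 G p b \<subseteq> W"
      by (intro GX_subsetI GX_Int act_in pr2_in W) (simp add: restr_act_pr2 bisectionD)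
  qed
  then have "{(a, b). \<alpha> a \<inter> GX_\<pi>2 G p b \<subseteq> W} =
      \<Inter>((\<lambda>v. {(a, b). inf (tr v a) b \<le> restr v W}) ` {v. bisection v})"
    by auto
  also have "\<dots> \<in> XX"
    using bisection_unit by (intro XX.Inter_in_pullback) (auto intro: XX_tr)
  finally show ?thesis .
qed

abbreviation is_orbit_section :: "'x \<Rightarrow> bool" where
  "is_orbit_section \<equiv> section_of orbits id"

lemma orbit_sectionD: "is_orbit_section s \<Longrightarrow> x \<le> s \<Longrightarrow> inf s (\<tau> x) = x"
  using section_ofD[of orbits id s x] by simp

text \<open>
  A pair \<open>(t, s)\<close> of sections of \<open>\<pi>\<close> with \<open>t = v \<cdot> s\<close> lies in the image of \<open>v \<otimes> s\<close>, and all pairs in the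
  kernel pair of \<open>\<pi>\<close> are covered by such, because \<open>\<tau> s\<close> is the union of the translates of \<open>s\<close>.
\<close>

lemma \<Phi>_reflects_inclusion:
  assumes lh: "local_homeomorphism UNIV orbits (id :: 'x \<Rightarrow> 'x)"
    and U: "U \<in> XX" and V: "V \<in> XX" and sub: "\<Phi> U \<subseteq> \<Phi> V"
  shows "U \<subseteq> V"
proof clarify
  fix a b assume ab: "(a, b) \<in> U"
  have om: "open_map UNIV orbits (id :: 'x \<Rightarrow> 'x)" using lh by (simp add: local_homeomorphism_def)
  have dense: "Sup {s. is_orbit_section s \<and> s \<le> x} = x" for x
    by (rule dense_if_cover[OF section_of_cover[OF lh]]) (rule section_of_down[OF om])
  have key: "(t, s) \<in> V"
    if t: "is_orbit_section t" "t \<le> a" and s: "is_orbit_section s" "s \<le> b" for t s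
  proof -
    have translate: "(t', s) \<in> V"
      if v: "bisection v" and t'_def: "t' = inf t (tr (gi G v) s)" for v t'
    proof -
      note v' = bisectionD(2)[OF v] and w' = bisectionD(2)[OF bisection_i[OF v]]
      \<comment> \<open>\<open>s'\<close> is the part of \<open>s\<close> that \<open>v\<close>
        carries onto \<open>t'\<close>.\<close>
      define s' where "s' = tr v t'"
      have s'_s: "s' \<le> s"
        using tr_mono[OF v', of t' "tr (gi G v) s"] tr_tr_i[OF v, of s] by (simp add: s'_def t'_def)
      have t'_eq: "tr (gi G v) s' = t'"
        using tr_le[OF w', of s] unfolding s'_def tr_i_tr[OF v]
        by (simp add: t'_def inf.absorb2 le_infI2 flip: img_d)
      have s'_v: "s' \<le> p (img (gr G) v)" unfolding s'_def by (rule tr_le[OF v'])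
      have \<tau>_t': "\<tau> t' = \<tau> s'" using \<tau>_tr[OF v s'_v] by (simp add: t'_eq)
      have t': "is_orbit_section t'" by (rule section_of_down[OF om t(1)]) (simp add: t'_def)
      have "(t', s') \<in> U"
        using XX_down[OF U ab, of t' s'] t(2) s(2) s'_s by (auto simp: t'_def le_infI1)
      then have "restr v (\<alpha> t' \<inter> GX_\<pi>2 G p s') \<le> restr v (\<Phi> V)"
        unfolding restr_def using sub \<Phi>_upper by (intro ev_mono) blast
      then have "s' \<le> ev (tr v) id V"
        by (simp add: restr_act_pr2 v' restr_\<Phi> flip: s'_def)
      then have s'_eq: "s' = (SUP (c, d)\<in>V. inf (inf s' (tr v c)) d)"
        by (simp add: ev_def inf.absorb1 inf_assoc case_prod_unfold flip: inf_SUP_frame)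
      have "(t', inf (inf s' (tr v c)) d) \<in> V" if cd: "(c, d) \<in> V" for c d
      proof -
        let ?x = "inf (inf s' (tr v c)) d"
        let ?y = "tr (gi G v) ?x"
        have "?y \<le> tr (gi G v) (tr v c)" by (rule tr_mono[OF w']) (simp add: le_infI1)
        then have "?y \<le> c" by (simp add: tr_i_tr[OF v])
        then have yx: "(?y, ?x) \<in> V" by (intro XX_down[OF V cd]) simp_all
        have "?y \<le> t'" unfolding t'_eq[symmetric] by (rule tr_mono[OF w']) (simp add: le_infI1)
        moreover have "\<tau> ?y = \<tau> ?x" by (rule \<tau>_tr[OF v]) (simp add: s'_v le_infI1)
        \<comment> \<open>\<open>?y\<close> is all of \<open>t'\<close> that meets the orbits of
          \<open>?x\<close>, so the swap rule may enlarge \<open>?y\<close> to \<open>t'\<close>. In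
          the same way \<open>s'\<close> is enlarged to \<open>s\<close> below.\<close>
        ultimately have "inf t' (\<tau> ?x) = ?y" using orbit_sectionD[OF t'] by metis
        then have "(t', inf ?x (\<tau> ?x)) \<in> V" using yx by (simp flip: XX_swap[OF V \<tau>_in])
        then show ?thesis by (simp add: inf.absorb1 \<tau>_unit)
      qed
      then have "(t', s') \<in> V"
        by (subst s'_eq) (auto intro: XX_Sup2[OF V])
      moreover have "inf s (\<tau> t') = s'" unfolding \<tau>_t' by (rule orbit_sectionD[OF s(1) s'_s])
      ultimately have "(inf t' (\<tau> t'), s) \<in> V" by (simp add: XX_swap[OF V \<tau>_in])
      then show ?thesis by (simp add: inf.absorb1 \<tau>_unit)
    qed
    have "(inf t (tr c s), s) \<in> V" if "bisection c" for c
      using translate[OF bisection_i[OF that] refl] by (simp add: i_i)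
    then have "(inf t (\<tau> s), s) \<in> V"
      unfolding \<tau>_eq inf_SUP_frame by (intro XX_Sup1[OF V]) auto
    then have "(t, inf s (\<tau> s)) \<in> V" by (simp add: XX_swap[OF V \<tau>_in])
    then show ?thesis by (simp add: inf.absorb1 \<tau>_unit)
  qed
  have "(t, b) \<in> V" if "is_orbit_section t" "t \<le> a" for t
    using XX_Sup2[OF V, of "{s. is_orbit_section s \<and> s \<le> b}" t] key[OF that] by (simp add: dense)
  then show "(a, b) \<in> V"
    using XX_Sup1[OF V, of "{t. is_orbit_section t \<and> t \<le> a}" b] by (simp add: dense)
qed

text \<open>If \<open>w z = v z'\<close> with \<open>z, z' \<in> y\<close>, then \<open>v\<inverse> w\<close> is a unit at \<open>z\<close>, so \<open>w\<close> and \<open>v\<close> agree there.\<close>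

lemma unit_bounded_translate:
  assumes y: "unit_bounded y" and v: "bisection v"
  shows "\<alpha> (tr (gi G v) y) \<inter> GX_\<pi>2 G p y \<subseteq> tensor (GX G p) v y"
proof (rule GX_subsetI)
  fix w assume "bisection w"
  then have w: "R.is_section w" by (rule bisectionD)
  let ?F = "\<lambda>a. pt w (S.tr (gi G v) a)"
  note i = bisection_i[OF v]
  have F: "composable (gr G) p ?F id" by (rule composable_tr_mult[OF w bisectionD(2)[OF i]])
  have pr2: "ev ?F id (GX_\<pi>2 G p y) = inf (?F top) y" and pr1: "ev ?F id (GX_\<pi>1 G p e) = ?F e"
    using PB_ev_tensor[OF F] by (simp_all add: proj1_def proj2_def one_UNIV flip: GX_def)
  have "inf (tr w (tr (gi G v) y)) y = inf (ev ?F id (\<alpha> y)) (inf (?F top) y)"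
    using ev_le_top[of ?F id "\<alpha> y"] F
    by (simp add: tr_mult[OF w i] composable_def inf.absorb1 flip: inf_assoc)
  also have "\<dots> = ev ?F id (\<alpha> y \<inter> GX_\<pi>2 G p y)"
    using PB_ev_Int[OF F, folded GX_def] by (simp add: act_in pr2_in pr2)
  also have "\<dots> \<le> ev ?F id (GX_\<pi>1 G p e)"
    using y unfolding unit_bounded_def by (rule ev_mono)
  also have "\<dots> = pt w v" by (simp add: pr1 tr_unit[OF i] i_i)
  finally show "restr w (\<alpha> (tr (gi G v) y) \<inter> GX_\<pi>2 G p y) \<le> restr w (tensor (GX G p) v y)"
    by (simp add: restr_act_pr2 w restr_tensor)
qed (simp_all add: GX_Int act_in pr2_in GX_tensor)

text \<open>For unit bounded \<open>z\<close>, \<open>unit_bounded_translate\<close> puts the box (v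
  z, z) into the preimage of any \<open>W\<close> containing \<open>(v, z)\<close>, and such pairs
  generate \<open>W\<close>.\<close>

lemma \<Phi>_surjective:
  assumes cover: "Sup {y. unit_bounded y} = top" and W: "W \<in> GX G p"
  shows "\<Phi> {(a, b). \<alpha> a \<inter> GX_\<pi>2 G p b \<subseteq> W} = W" (is "\<Phi> ?U = W")
proof
  show "\<Phi> ?U \<subseteq> W" by (rule \<Phi>_least[OF W]) auto
  show "W \<subseteq> \<Phi> ?U"
  proof clarify
    fix a y assume ay: "(a, y) \<in> W"
    have "(v, y) \<in> \<Phi> ?U" if v: "bisection v" "v \<le> a" for v
    proof -
      have "(v, z) \<in> \<Phi> ?U" if z: "unit_bounded z" "z \<le> y" for z
      proof -
        have "(v, z) \<in> W" using GX_down[OF W ay] v z by simp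
        then have "tensor (GX G p) v z \<subseteq> W" by (simp add: GX_tensor W)
        then have U: "(tr (gi G v) z, z) \<in> ?U" using unit_bounded_translate[OF z(1) v(1)] by auto
        have "(v, z) \<in> \<alpha> (tr (gi G v) z) \<inter> GX_\<pi>2 G p z"
          using bisection_act_adjoint[OF v(1)] pr2_mem by auto
        then show ?thesis using \<Phi>_upper[OF U] by (rule subsetD[rotated])
      qed
      then have "(v, Sup {z. unit_bounded z \<and> z \<le> y}) \<in> \<Phi> ?U" by (intro GX_Sup2[OF \<Phi>_in]) auto
      then show ?thesis by (simp add: dense_if_cover[OF cover unit_bounded_down])
    qed
    then show "(a, y) \<in> \<Phi> ?U" using mem_iff_bisections[OF \<Phi>_in] by blast
  qed
qed

section \<open>Principally covered bisheaves are principal\<close>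

lemma principally_covered_iff:
  "principally_covered_sheaf G p \<alpha> \<longleftrightarrow> Sup {s. P.is_section s \<and> unit_bounded s} = top"
proof -
  have "principal_sections G p \<alpha> = {s. P.is_section s \<and> unit_bounded s}"
    using principal_sections_iff by auto
  then show ?thesis using sheaf by (simp add: principally_covered_sheaf_def)
qed

lemma principal_if_covered_bisheaf:
  assumes "principally_covered_sheaf G p \<alpha>" and "bisheaf G p \<alpha>"
  shows "principal_G_sheaf G p \<alpha>"
proof -
  have lh: "local_homeomorphism UNIV orbits (id :: 'x \<Rightarrow> 'x)"
    using assms(2) by (simp add: bisheaf_def)
  have "Sup {s. P.is_section s \<and> unit_bounded s} \<le> Sup {s. unit_bounded s}"
    by (rule Sup_subset_mono) auto
  then have cover: "Sup {s. unit_bounded s} = top"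
    using assms(1) by (simp add: principally_covered_iff top_unique)
  have le: "\<Phi> U \<subseteq> \<Phi> V \<longleftrightarrow> U \<subseteq> V" if "U \<in> XX" "V \<in> XX" for U V
    using that \<Phi>_reflects_inclusion[OF lh] \<Phi>_mono by blast
  have "inj_on \<Phi> XX"
    by (rule inj_onI) (metis le order_refl subset_antisym)
  moreover have "\<Phi> ` XX = GX G p"
  proof (intro subset_antisym subsetI)
    fix W assume W: "W \<in> GX G p"
    from \<Phi>_surjective[OF cover W, symmetric] preimage_in_XX[OF W] show "W \<in> \<Phi> ` XX"
      by (rule image_eqI)
  qed (auto intro: \<Phi>_in)
  ultimately have "order_iso XX (GX G p) \<Phi>"
    using le by (simp add: order_iso_def bij_betw_def)
  then have "locale_iso (GX G p) XX \<Phi>"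
    by (rule order_iso_imp_locale_iso[OF GX_carrier XX.pullback_carrier])
  then show ?thesis
    using sheaf lh by (simp add: principal_G_sheaf_def surjection_def local_homeomorphism_def)
qed

section \<open>Sections and covers of a principal sheaf\<close>

context
  assumes principal: "principal_G_sheaf G p \<alpha>"
begin

lemma \<Phi>_reflects_inclusion_principal:
  assumes U: "U \<in> XX" and V: "V \<in> XX" and sub: "\<Phi> U \<subseteq> \<Phi> V"
  shows "U \<subseteq> V"
proof -
  obtain g where g: "locale_map XX (GX G p) g" "\<And>U. U \<in> XX \<Longrightarrow> g (\<Phi> U) = U"
    using principal by (auto simp: principal_G_sheaf_def locale_iso_def)
  have "g (meet (GX G p) (\<Phi> U) (\<Phi> V)) = meet XX (g (\<Phi> U)) (g (\<Phi> V))"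
    using g(1) \<Phi>_in by (simp add: locale_map_def)
  moreover have "meet (GX G p) (\<Phi> U) (\<Phi> V) = \<Phi> U" using sub by (simp add: GX_meet \<Phi>_in Int_absorb2)
  ultimately have "U = U \<inter> V" using g(2) U V by (simp add: XX.meet_pullback)
  then show ?thesis by blast
qed

text \<open>The diagonal of \<open>X\<close> is open in the kernel pair of \<open>\<pi>\<close>, since the units are open in \<open>G\<^sub>1\<close>.\<close>

lemma diagonal_open:
  obtains D where "D \<in> XX" "\<Phi> D = GX_\<pi>1 G p e"
proof -
  obtain g where "locale_map XX (GX G p) g" "\<And>W. W \<in> GX G p \<Longrightarrow> \<Phi> (g W) = W"
    using principal by (auto simp: principal_G_sheaf_def locale_iso_def)
  then show ?thesis using that[of "g (GX_\<pi>1 G p e)"] pr1_in by (simp add: locale_map_def image_subset_iff)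
qed

text \<open>\<open>\<Phi>\<close> sends the tensor of \<open>s\<close> with itself to
  \<open>\<alpha> s \<inter> GX_\<pi>2 G p s\<close>, as seen on bisections, and it reflects
  inclusions.\<close>

lemma mem_diagonal_iff:
  assumes D: "D \<in> XX" "\<Phi> D = GX_\<pi>1 G p e"
  shows "(s, s) \<in> D \<longleftrightarrow> unit_bounded s"
proof
  assume "(s, s) \<in> D"
  then show "unit_bounded s" using \<Phi>_upper[of s s D] D(2) by (simp add: unit_bounded_def)
next
  assume s: "unit_bounded s"
  let ?T = "tensor XX s s"
  have T: "?T \<in> XX" by (simp add: XX.tensor_in)
  have "\<Phi> ?T \<subseteq> GX_\<pi>1 G p e"
  proof (rule GX_subsetI[OF \<Phi>_in pr1_in])
    fix v assume v: "bisection v"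
    have "restr v (\<alpha> s \<inter> GX_\<pi>2 G p s) \<le> restr v (GX_\<pi>1 G p e)"
      using s unfolding unit_bounded_def restr_def by (rule ev_mono)
    then show "restr v (\<Phi> ?T) \<le> restr v (GX_\<pi>1 G p e)"
      by (simp add: restr_\<Phi> XX_tr v bisectionD restr_act_pr2)
  qed
  then have "?T \<subseteq> D" using \<Phi>_reflects_inclusion_principal[OF T D(1)] D(2) by simp
  then show "(s, s) \<in> D" using XX.tensor_mem[of s s] by auto
qed

text \<open>On the diagonal both coordinates agree, so the tensor of \<open>s\<close> and
  \<open>x\<close> lies below that of \<open>x\<close> and \<open>top\<close>. The direct image
  under the first projection takes the tensor of a and b to \<open>inf a (\<tau> b)\<close>, which
  gives the bound.\<close>

lemma unit_bounded_imp_orbit_section: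
  assumes s: "unit_bounded s"
  shows "is_orbit_section s"
  unfolding section_of_def
proof (intro allI impI antisym)
  fix x assume x: "x \<le> s"
  let ?T = "tensor XX s x" and ?T' = "tensor XX x top"
  have T: "?T \<in> XX" "?T' \<in> XX" by (simp_all add: XX.tensor_in)
  have "\<Phi> ?T \<subseteq> \<Phi> ?T'"
  proof (rule GX_subsetI[OF \<Phi>_in \<Phi>_in])
    fix v assume v: "bisection v"
    note v' = bisectionD(2)[OF v]
    \<comment> \<open>\<open>?w\<close> is the part of \<open>v\<close> made of units. As
      \<open>?y\<close> lies over its range, \<open>v\<close> acts on \<open>?y\<close> as
      \<open>?w\<close> does, trivially.\<close>
    let ?w = "inf v e" and ?y = "inf (tr v s) x"
    have "restr v (\<alpha> s \<inter> GX_\<pi>2 G p s) \<le> restr v (GX_\<pi>1 G p e)"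
      using s unfolding unit_bounded_def restr_def by (rule ev_mono)
    then have "?y \<le> p (img (gr G) ?w)"
      using x by (simp add: restr_act_pr2 v' restr_pr1 pt_def) (meson inf_mono order_refl order_trans)
    then have y: "inf ?y (p (img (gr G) ?w)) = ?y" by (rule inf.absorb1)
    have "inf v (gr G (img (gr G) ?w)) = ?w" using v' by (rule section_ofD) simp
    moreover have "(?w, ?y) \<in> \<alpha> x" by (rule GX_down[OF act_in unit_act]) simp_all
    ultimately have "(v, ?y) \<in> \<alpha> x" using GX_swap[OF act_in, of v "img (gr G) ?w" ?y x] y by simp
    then have "?y \<le> tr v x"
      using tr_le[OF v', of s] by (simp add: mem_act_iff v' inf.absorb1 le_infI1)
    then show "restr v (\<Phi> ?T) \<le> restr v (\<Phi> ?T')" by (simp add: restr_\<Phi> v' XX_tr v)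
  qed
  then have "?T \<subseteq> ?T'" by (rule \<Phi>_reflects_inclusion_principal[OF T])
  then have mem: "(s, x) \<in> ?T'" using XX.tensor_mem[of x s] by auto
  have I: "{(a, b). inf a (\<tau> b) \<le> x} \<in> XX"
  proof (rule XX.pullbackI)
    show "(a, b) \<in> {(a, b). inf a (\<tau> b) \<le> x}"
      if "(a', b') \<in> {(a, b). inf a (\<tau> b) \<le> x}" "a \<le> a'" "b \<le> b'" for a b a' b'
      using that \<tau>_mono[of b b'] by (auto intro: order_trans[OF inf_mono])
    show "(Sup S, b) \<in> {(a, b). inf a (\<tau> b) \<le> x}"
      if "\<And>a. a \<in> S \<Longrightarrow> (a, b) \<in> {(a, b). inf a (\<tau> b) \<le> x}" for S b
      using that SUP_inf_frame[of "\<lambda>a. a" S] by (auto intro!: SUP_least)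
    show "(a, join UNIV T) \<in> {(a, b). inf a (\<tau> b) \<le> x}"
      if "\<And>b. b \<in> T \<Longrightarrow> (a, b) \<in> {(a, b). inf a (\<tau> b) \<le> x}" for a T
      using that by (auto simp: join_UNIV \<tau>_Sup inf_SUP_frame intro!: SUP_least)
    show "(inf a (id c), b) \<in> {(a, b). inf a (\<tau> b) \<le> x} \<longleftrightarrow>
        (a, meet UNIV b (id c)) \<in> {(a, b). inf a (\<tau> b) \<le> x}" if "c \<in> orbits" for a b c
    proof -
      have "inf (inf a c) (\<tau> b) = inf a (\<tau> (inf b c))"
        using that by (simp add: \<tau>_frobenius ac_simps)
      then show ?thesis by (simp add: meet_UNIV)
    qed
  qed auto
  have "?T' \<subseteq> {(a, b). inf a (\<tau> b) \<le> x}" by (subst XX.tensor_le_iff[OF _ I]) simp_all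
  then show "inf s (id (\<tau> x)) \<le> x" using mem by auto
  show "x \<le> inf s (id (\<tau> x))" using x \<tau>_unit by simp
qed

text \<open>Evaluating \<open>\<Phi> D\<close> at the points (1, z) restricts \<open>D\<close> to
  the diagonal of \<open>X\<close>, where it is everything. A box (a, b) in \<open>D\<close>
  contains the square on \<open>inf a b\<close>.\<close>

lemma unit_bounded_cover: "Sup {s. unit_bounded s} = top"
proof -
  obtain D where D: "D \<in> XX" "\<Phi> D = GX_\<pi>1 G p e" by (rule diagonal_open)
  let ?f = "\<lambda>a. p (gu G a)"
  have "partial_point ?f"
    using partial_point_comp[OF partial_point_u partial_point_p] by (simp add: o_def)
  then have f: "composable (gr G) p ?f id"
    by (simp add: composable_def partial_point_id u_r u_top p_top)
  have f2: "ev ?f id (GX_\<pi>2 G p y) = y" and f1: "ev ?f id (GX_\<pi>1 G p e) = top" for y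
    using PB_ev_tensor[OF f] by (simp_all add: proj1_def proj2_def one_UNIV u_top p_top u_unit flip: GX_def)
  have "ev ?f id (\<Phi> D) = ev (\<lambda>x. x) (\<lambda>y. y) D"
    using PB_ev_pairing[OF f, of \<alpha> "GX_\<pi>2 G p" D] act_in pr2_in
    by (simp add: act_unit f2 flip: GX_def)
  then have "top = (SUP (a, b)\<in>D. inf a b)" unfolding D(2) f1 by (simp add: ev_def)
  also have "\<dots> \<le> Sup {s. unit_bounded s}"
  proof (rule SUP_least, clarify)
    fix a b assume "(a, b) \<in> D"
    then have "(inf a b, inf a b) \<in> D" by (rule XX_down[OF D(1)]) simp_all
    then show "inf a b \<le> Sup {s. unit_bounded s}"
      using mem_diagonal_iff[OF D] by (auto intro: Sup_upper)
  qed
  finally show ?thesis by (simp add: top_unique)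
qed

lemma principal_imp_principally_covered: "principally_covered_sheaf G p \<alpha>"
  unfolding principally_covered_iff
proof -
  have "Sup {t. P.is_section t} \<le> Sup {s. P.is_section s \<and> unit_bounded s}"
  proof (rule Sup_least, clarify)
    fix t assume t: "P.is_section t"
    have "t = Sup {s. unit_bounded s \<and> s \<le> t}"
      by (simp add: dense_if_cover[OF unit_bounded_cover unit_bounded_down])
    also have "\<dots> \<le> Sup {s. P.is_section s \<and> unit_bounded s}"
      using P.section_down[OF t] by (intro Sup_subset_mono) auto
    finally show "t \<le> Sup {s. P.is_section s \<and> unit_bounded s}" .
  qed
  then show "Sup {s. P.is_section s \<and> unit_bounded s} = top"
    by (simp add: P.sections_cover top_unique)
qed

lemma principal_imp_bisheaf: "bisheaf G p \<alpha>"
proof -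
  have om: "open_map UNIV orbits (id :: 'x \<Rightarrow> 'x)" using principal by (simp add: principal_G_sheaf_def)
  have "local_homeomorphism UNIV orbits (id :: 'x \<Rightarrow> 'x)"
    unfolding local_homeomorphism_def
    using om unit_bounded_cover unit_bounded_imp_orbit_section order_iso_iff_section_of[OF om]
    by (intro conjI exI[of _ "{s. unit_bounded s}"]) (simp_all add: join_UNIV one_UNIV)
  then show ?thesis using sheaf by (simp add: bisheaf_def)
qed

text \<open>Cover \<open>s\<close> by unit bounded \<open>t\<close>. As
  \<open>inf s (\<tau> t) = t\<close>, the swap rule enlarges \<open>(t, t)\<close> in
  \<open>D\<close> to \<open>(t, s)\<close>, and joining over \<open>t\<close> gives
  \<open>(s, s)\<close>.\<close>

lemma orbit_section_imp_unit_bounded: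
  assumes s: "is_orbit_section s"
  shows "unit_bounded s"
proof -
  obtain D where D: "D \<in> XX" "\<Phi> D = GX_\<pi>1 G p e" by (rule diagonal_open)
  have "(t, s) \<in> D" if t: "unit_bounded t" "t \<le> s" for t
  proof -
    have "(t, inf s (\<tau> t)) \<in> D"
      using t mem_diagonal_iff[OF D] orbit_sectionD[OF s] by simp
    then have "(inf t (\<tau> t), s) \<in> D" by (simp add: XX_swap[OF D(1) \<tau>_in])
    then show ?thesis by (simp add: inf.absorb1 \<tau>_unit)
  qed
  then have "(Sup {t. unit_bounded t \<and> t \<le> s}, s) \<in> D" by (intro XX_Sup1[OF D(1)]) auto
  then have "(s, s) \<in> D" by (simp add: dense_if_cover[OF unit_bounded_cover unit_bounded_down])
  then show ?thesis using mem_diagonal_iff[OF D] by simp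
qed

lemma principal_sections_eq_local_bisections:
  "principal_sections G p \<alpha> = local_bisections G p \<alpha>"
proof -
  have "orbit_sections G p \<alpha> = {s. is_orbit_section s}"
    by (simp add: orbit_sections_def section_of_def)
  then show ?thesis
    using unit_bounded_imp_orbit_section orbit_section_imp_unit_bounded
    by (auto simp: local_bisections_def principal_sections_iff local_sections_iff)
qed

end

end

theorem theorem5p10:
  fixes G :: "('o::frame, 'g::frame) groupoid"
    and p :: "'o \<Rightarrow> 'x::frame"
    and \<alpha> :: "'x \<Rightarrow> ('g \<times> 'x) set"
  assumes "etale_groupoid G" and "G_sheaf G p \<alpha>"
  shows "(principally_covered_sheaf G p \<alpha> \<and> bisheaf G p \<alpha> \<longleftrightarrow> principal_G_sheaf G p \<alpha>) \<and>
         (principal_G_sheaf G p \<alpha> \<longrightarrow> principal_sections G p \<alpha> = local_bisections G p \<alpha>)"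
proof -
  interpret etale_action G p \<alpha> by unfold_locales fact+
  show ?thesis
    using principal_if_covered_bisheaf principal_imp_principally_covered principal_imp_bisheaf
      principal_sections_eq_local_bisections
    by blast
qed

end
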